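(* Let $A$ be the dg-algebra of simplicial cochains over $\mathbb Z_2$ of the tetrahedral triangulation of $S^2$ (with basis $e_j$, $b_{ij}$, $c_{ijl}$ as in the context), and let $B=H^\bullet(S^2;\mathbb Z_2)\cong\mathbb Z_2 e\oplus\mathbb Z_2 s$ with zero differential, $|e|=0$, $|s|=-2$, $e$ the unit and $s\cdot s=0$. Then the map $f:B\to A$, $f(e):=e_0+e_1+e_2+e_3$, $f(s):=c_{012}$, is a dg-algebra quasi-isomorphism. Moreover, let $F=F^{[012]}+F^{[013]}+F^{[023]}+F^{[123]}$ be the local homotopy inner product for $A$ defined in the context. Then the transferred homotopy inner product $f(F)$ for $B$ equals $\widetilde F$, where $\widetilde F$ is the homotopy inner product for $B$ whose only non-zero values on basis elements are $$\widetilde F_{0,0}(s)(e)=1,\qquad \widetilde F_{0,0}(e)(s)=1,\qquad \widetilde F_{2,0}(\underline s,\underline s;e)(e)=1.$$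
   Context: The ground ring is $\mathbb Z_2$, so signs are omitted. Differentials lower degree by one. $\underline A$ denotes $A$ shifted up by one, $\underline A_j=A_{j-1}$, and $A^*$ is the dual, $A^*_j=\mathrm{Hom}(A_{-j},\mathbb Z_2)$. **Homotopy inner products.** For a unital dg-algebra $A$ and a family $F=\{F_{p,q}:\underline A^{\otimes p}\otimes A\otimes\underline A^{\otimes q}\to A^*\}_{p,q\ge0}$ define $\mathcal D F$ as follows: $(\mathcal DF)_{p,q}(\underline{a_1},\dots,\underline{a_p};m;\underline{b_1},\dots,\underline{b_q})(n)$ is the sum of all terms obtained from $F_{p,q}(\underline{a_1},\dots,\underline{a_p};m;\underline{b_1},\dots,\underline{b_q})(n)$ by applying $d$ to exactly one of the inputs $a_1,\dots,a_p,m,b_1,\dots,b_q,n$, plus the following terms: if $p\ge1$, $F_{p-1,q}(\underline{a_2},\dots,\underline{a_p};m;\underline{b_1},\dots,\underline{b_q})(n a_1)$, $\sum_{j=1}^{p-1}F_{p-1,q}(\underline{a_1},\dots,\underline{a_ja_{j+1}},\dots,\underline{a_p};m;\underline{b_1},\dots,\underline{b_q})(n)$, $F_{p-1,q}(\underline{a_1},\dots,\underline{a_{p-1}};a_pm;\underline{b_1},\dots,\underline{b_q})(n)$; if $q\ge1$, $F_{p,q-1}(\underline{a_1},\dots,\underline{a_p};mb_1;\underline{b_2},\dots,\underline{b_q})(n)$, $\sum_{j=1}^{q-1}F_{p,q-1}(\underline{a_1},\dots,\underline{a_p};m;\underline{b_1},\dots,\underline{b_jb_{j+1}},\dots,\underline{b_q})(n)$,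 $F_{p,q-1}(\underline{a_1},\dots,\underline{a_p};m;\underline{b_1},\dots,\underline{b_{q-1}})(b_qn)$. $F$ is a homotopy inner product for $A$ if $\mathcal DF=0$ (and $F$ vanishes when one of the underlined inputs is $\underline 1$). **Transfer.** For a dg-algebra map $f:B\to A$ and a homotopy inner product $F$ for $A$, the transferred homotopy inner product $f(F)$ for $B$ is $f(F)_{p,q}(\underline{x_1},\dots,\underline{x_p};m;\underline{y_1},\dots,\underline{y_q})(n)=F_{p,q}(\underline{f(x_1)},\dots,\underline{f(x_p)};f(m);\underline{f(y_1)},\dots,\underline{f(y_q)})(f(n))$. **The algebra $A$.** Basis $e_j$ ($0\le j\le3$, degree $0$), $b_{ij}$ ($0\le i<j\le3$, degree $-1$), $c_{ijl}$ ($0\le i<j<l\le3$, degree $-2$); the differential sends a basis element indexed by a simplex to the sum of the basis elements indexed by simplices of one dimension higher containing it, i.e. $d(e_j)=\sum_{i\ne j}b_{\{ij\}}$, $d(b_{ij})=\sum_{l\neq i,j}c_{\{ijl\}}$, $d(c_{ijl})=0$, where braces mean the indices are put in ascending order. Non-zero products of basis elements: $e_je_j=e_j$; $e_ib_{ij}=b_{ij}=b_{ij}e_j$; $e_ic_{ijl}=c_{ijl}=c_{ijl}e_l$; $b_{ij}b_{jl}=c_{ijl}$ (for $i<j<l$). The unit is $e_0+e_1+e_2+e_3$. **The maps $F^{[ijl]}$.** For $0\le i<j<l\le 3$, $F^{[ijl]}$ has only components with $q=0$, with only the following non-zero values on basis elements. For all $k\ge0$ (with $k$ copies of $\underline{b_{il}}$):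 $F_{k,0}(\underline{b_{il}},\dots,\underline{b_{il}};m)(n)=1$ for $(m,n)\in\{(c_{ijl},e_l),(e_i,c_{ijl}),(b_{ij},b_{jl})\}$. For all $k\ge0$, $1\le t\le k+1$, with $\underline{c_{ijl}}$ in the $t$-th of $k+1$ positions: $F_{k+1,0}(\underline{b_{ij}},\dots,\underline{b_{ij}},\underline{c_{ijl}},\underline{b_{il}},\dots,\underline{b_{il}};m)(n)=1$ for $(m,n)\in\{(e_i,b_{ij}),(b_{ij},e_j)\}$ and $F_{k+1,0}(\underline{b_{il}},\dots,\underline{b_{il}},\underline{c_{ijl}},\underline{b_{jl}},\dots,\underline{b_{jl}};m)(n)=1$ for $(m,n)\in\{(e_j,b_{jl}),(b_{jl},e_l)\}$. For all $k\ge0$, $1\le t_1<t_2\le k+2$, with $\underline{c_{ijl}}$ in positions $t_1$ and $t_2$ of $k+2$ positions: $F_{k+2,0}(\underline{b_{ij}},\dots,\underline{b_{ij}},\underline{c_{ijl}},\underline{b_{il}},\dots,\underline{b_{il}},\underline{c_{ijl}},\underline{b_{jl}},\dots,\underline{b_{jl}};e_j)(e_j)=1$. *)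

theory Defs
  imports "HOL-Analysis.Analysis" "HOL-Library.Z2"
begin

section \<open>Unital dg-algebras over Z/2\<close>

text \<open>
  The ground field is \<^typ>\<open>bit\<close>. A graded algebra is an internally graded vector space:
  \<open>gr D i\<close> is the homogeneous part of degree \<open>i\<close>. The differential lowers degree by one;
  signs are omitted since the characteristic is two.
\<close>

record 'a dga =
  scl :: "bit \<Rightarrow> 'a \<Rightarrow> 'a"
  gr :: "int \<Rightarrow> 'a set"
  mul :: "'a \<Rightarrow> 'a \<Rightarrow> 'a"
  unit :: 'a
  diff :: "'a \<Rightarrow> 'a"

locale unital_dga = vector_space "scl D" for D :: "'a::ab_group_add dga" +
  assumes gr_subspace: "subspace (gr D i)"
    and gr_direct_sum:
      "\<exists>!h :: int \<Rightarrow> 'a. (\<forall>i. h i \<in> gr D i) \<and> finite {i. h i \<noteq> 0} \<and> x = (\<Sum>i | h i \<noteq> 0. h i)"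
    and mul_linear_left: "Vector_Spaces.linear (scl D) (scl D) (\<lambda>x. mul D x y)"
    and mul_linear_right: "Vector_Spaces.linear (scl D) (scl D) (\<lambda>y. mul D x y)"
    and mul_gr: "x \<in> gr D i \<Longrightarrow> y \<in> gr D j \<Longrightarrow> mul D x y \<in> gr D (i + j)"
    and mul_assoc: "mul D (mul D x y) z = mul D x (mul D y z)"
    and unit_gr: "unit D \<in> gr D 0"
    and unit_left: "mul D (unit D) x = x"
    and unit_right: "mul D x (unit D) = x"
    and diff_linear: "Vector_Spaces.linear (scl D) (scl D) (diff D)"
    and diff_gr: "x \<in> gr D i \<Longrightarrow> diff D x \<in> gr D (i - 1)"
    and diff_diff: "diff D (diff D x) = 0"
    and leibniz: "diff D (mul D x y) = mul D (diff D x) y + mul D x (diff D y)"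

definition dga_map :: "'b::ab_group_add dga \<Rightarrow> 'a::ab_group_add dga \<Rightarrow> ('b \<Rightarrow> 'a) \<Rightarrow> bool" where
  "dga_map B A f \<longleftrightarrow>
     unital_dga B \<and> unital_dga A \<and>
     Vector_Spaces.linear (scl B) (scl A) f \<and>
     (\<forall>i. f ` gr B i \<subseteq> gr A i) \<and>
     (\<forall>x y. f (mul B x y) = mul A (f x) (f y)) \<and>
     f (unit B) = unit A \<and>
     (\<forall>x. f (diff B x) = diff A (f x))"

definition cycles :: "'a::ab_group_add dga \<Rightarrow> int \<Rightarrow> 'a set" where
  "cycles D i = {x \<in> gr D i. diff D x = 0}"

definition homologous :: "'a::ab_group_add dga \<Rightarrow> int \<Rightarrow> ('a \<times> 'a) set" where
  "homologous D i =
     {(x, y). x \<in> cycles D i \<and> y \<in> cycles D i \<and> x - y \<in> diff D ` gr D (i + 1)}"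

definition homology :: "'a::ab_group_add dga \<Rightarrow> int \<Rightarrow> 'a set set" where
  "homology D i = cycles D i // homologous D i"

text \<open>The induced map sends the class of a cycle \<open>x\<close> to the class of \<open>f x\<close>.\<close>

definition homology_map :: "'a::ab_group_add dga \<Rightarrow> int \<Rightarrow> ('b \<Rightarrow> 'a) \<Rightarrow> 'b set \<Rightarrow> 'a set" where
  "homology_map A i f X = homologous A i `` (f ` X)"

definition dga_quasi_iso ::
    "'b::ab_group_add dga \<Rightarrow> 'a::ab_group_add dga \<Rightarrow> ('b \<Rightarrow> 'a) \<Rightarrow> bool" where
  "dga_quasi_iso B A f \<longleftrightarrow>
     dga_map B A f \<and> (\<forall>i. bij_betw (homology_map A i f) (homology B i) (homology A i))"


section \<open>Homotopy inner products\<close>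

text \<open>
  A family is written \<open>F as m bs n\<close> for the value
  \<open>F\<^sub>p\<^sub>,\<^sub>q(as; m; bs)(n)\<close>, where \<open>p = length as\<close> and \<open>q = length bs\<close>.
\<close>

type_synonym 'a family = "'a list \<Rightarrow> 'a \<Rightarrow> 'a list \<Rightarrow> 'a \<Rightarrow> bit"

text \<open>
  The graded dual is the direct sum of the duals of the homogeneous parts: its elements are the
  linear functionals vanishing on all but finitely many degrees.
\<close>

definition graded_dual :: "'a::ab_group_add dga \<Rightarrow> ('a \<Rightarrow> bit) set" where
  "graded_dual D =
     {\<phi>. Vector_Spaces.linear (scl D) (*) \<phi> \<and> finite {i. \<exists>n \<in> gr D i. \<phi> n \<noteq> 0}}"

definition multilinear_family :: "'a::ab_group_add dga \<Rightarrow> 'a family \<Rightarrow> bool" where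
  "multilinear_family D F \<longleftrightarrow>
     (\<forall>as m bs. F as m bs \<in> graded_dual D) \<and>
     (\<forall>as bs n. Vector_Spaces.linear (scl D) (*) (\<lambda>m. F as m bs n)) \<and>
     (\<forall>as m bs n. \<forall>k < length as.
        Vector_Spaces.linear (scl D) (*) (\<lambda>x. F (as[k := x]) m bs n)) \<and>
     (\<forall>as m bs n. \<forall>k < length bs.
        Vector_Spaces.linear (scl D) (*) (\<lambda>x. F as m (bs[k := x]) n))"

text \<open>Replaces the two adjacent entries at positions \<open>k\<close> and \<open>k + 1\<close> by their product.\<close>

definition contract :: "'a dga \<Rightarrow> nat \<Rightarrow> 'a list \<Rightarrow> 'a list" where
  "contract D k xs = take k xs @ [mul D (xs ! k) (xs ! (k + 1))] @ drop (k + 2) xs"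

definition DF :: "'a dga \<Rightarrow> 'a family \<Rightarrow> 'a family" where
  "DF D F as m bs n =
     (\<Sum>k<length as. F (as[k := diff D (as ! k)]) m bs n)
     + F as (diff D m) bs n
     + (\<Sum>k<length bs. F as m (bs[k := diff D (bs ! k)]) n)
     + F as m bs (diff D n)
     + (if as = [] then 0 else
          F (tl as) m bs (mul D n (hd as))
          + (\<Sum>k<length as - 1. F (contract D k as) m bs n)
          + F (butlast as) (mul D (last as) m) bs n)
     + (if bs = [] then 0 else
          F as (mul D m (hd bs)) (tl bs) n
          + (\<Sum>k<length bs - 1. F as m (contract D k bs) n)
          + F as m (butlast bs) (mul D (last bs) n))"

definition homotopy_inner_product :: "'a::ab_group_add dga \<Rightarrow> 'a family \<Rightarrow> bool" where
  "homotopy_inner_product D F \<longleftrightarrow>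
     multilinear_family D F \<and>
     (\<forall>as m bs n. DF D F as m bs n = 0) \<and>
     (\<forall>as m bs n. unit D \<in> set as \<union> set bs \<longrightarrow> F as m bs n = 0)"

definition transferred :: "('b \<Rightarrow> 'a) \<Rightarrow> 'a family \<Rightarrow> 'b family" where
  "transferred f F xs m ys n = F (map f xs) (f m) (map f ys) (f n)"


section \<open>Algebras and families given on a finite basis\<close>

text \<open>
  The basis vector of \<^typ>\<open>(bit, 'i::finite) vec\<close> with index \<open>\<alpha>\<close> is \<open>axis \<alpha> 1\<close>; the product and
  the differential are extended (bi)linearly.
\<close>

definition based_dga ::
    "('i::finite \<Rightarrow> int) \<Rightarrow> ('i \<Rightarrow> 'i \<Rightarrow> bit ^ 'i) \<Rightarrow> bit ^ 'i \<Rightarrow> ('i \<Rightarrow> bit ^ 'i) \<Rightarrow> (bit ^ 'i) dga"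
  where
  "based_dga deg mb u db =
     \<lparr> scl = (*s),
       gr = (\<lambda>i. {x. \<forall>\<alpha>. x $ \<alpha> \<noteq> 0 \<longrightarrow> deg \<alpha> = i}),
       mul = (\<lambda>x y. \<Sum>\<alpha>\<in>UNIV. \<Sum>\<beta>\<in>UNIV. (x $ \<alpha> * y $ \<beta>) *s mb \<alpha> \<beta>),
       unit = u,
       diff = (\<lambda>x. \<Sum>\<alpha>\<in>UNIV. x $ \<alpha> *s db \<alpha>) \<rparr>"

lemma based_dga_mul_axis:
  "mul (based_dga deg mb u db) (axis \<alpha> 1) (axis \<beta> 1) = mb \<alpha> \<beta>"
proof -
  have "(\<Sum>\<beta>'\<in>UNIV. (axis \<alpha> (1::bit) $ \<alpha>' * axis \<beta> 1 $ \<beta>') *s mb \<alpha>' \<beta>')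
      = (if \<alpha>' = \<alpha> then mb \<alpha> \<beta> else 0)" for \<alpha>'
  proof -
    have "(axis \<alpha> (1::bit) $ \<alpha>' * axis \<beta> 1 $ \<beta>') *s mb \<alpha>' \<beta>'
        = (if \<beta>' = \<beta> then (if \<alpha>' = \<alpha> then mb \<alpha> \<beta> else 0) else 0)" for \<beta>'
      by (cases "\<alpha>' = \<alpha>"; cases "\<beta>' = \<beta>") (simp_all add: axis_def)
    then show ?thesis by simp
  qed
  then show ?thesis by (simp only: based_dga_def dga.simps sum.delta finite UNIV_I if_True)
qed

lemma based_dga_diff_axis: "diff (based_dga deg mb u db) (axis \<alpha> 1) = db \<alpha>"
proof -
  have "axis \<alpha> (1::bit) $ \<alpha>' *s db \<alpha>' = (if \<alpha>' = \<alpha> then db \<alpha> else 0)" for \<alpha>'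
    by (cases "\<alpha>' = \<alpha>") (simp_all add: axis_def)
  then show ?thesis by (simp only: based_dga_def dga.simps sum.delta finite UNIV_I if_True)
qed

text \<open>
  The multilinear family with value 1 on the tuples of basis vectors whose indices lie in \<open>S\<close>,
  and value 0 on all other tuples of basis vectors.
\<close>

definition family_of_support ::
    "('i::finite list \<times> 'i \<times> 'i list \<times> 'i) set \<Rightarrow> (bit ^ 'i) family" where
  "family_of_support S as m bs n =
     (\<Sum>\<alpha> | length \<alpha> = length as. \<Sum>\<mu>\<in>UNIV. \<Sum>\<beta> | length \<beta> = length bs. \<Sum>\<nu>\<in>UNIV.
        (\<Prod>k<length as. as ! k $ \<alpha> ! k) * m $ \<mu> * (\<Prod>k<length bs. bs ! k $ \<beta> ! k) * n $ \<nu>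
        * of_bool ((\<alpha>, \<mu>, \<beta>, \<nu>) \<in> S))"


section \<open>Simplicial cochains of the boundary of the tetrahedron\<close>

text \<open>A simplex is its set of vertices: a nonempty proper subset of \<open>{0..3}\<close>.\<close>

typedef face = "{\<sigma> :: nat set. \<sigma> \<noteq> {} \<and> \<sigma> \<subset> {0..3}}"
  morphisms verts Face
proof (rule exI, rule CollectI, rule conjI)
  show "{0} \<noteq> ({} :: nat set)" by (rule insert_not_empty)
  have "(3::nat) \<in> {0..3}" "(3::nat) \<notin> {0}" "{0} \<subseteq> {0..3::nat}" by simp_all
  then show "{0} \<subset> {0..3::nat}" by (metis psubsetI)
qed

instance face :: finite
proof
  have "(UNIV :: face set) \<subseteq> Face ` Pow {0..3}"
  proof
    fix \<sigma> :: face
    have "\<sigma> = Face (verts \<sigma>)" by (simp add: verts_inverse)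
    then show "\<sigma> \<in> Face ` Pow {0..3}" using verts[of \<sigma>] by blast
  qed
  then show "finite (UNIV :: face set)" by (rule finite_subset) simp
qed

text \<open>
  The cochain dual to \<open>\<sigma>\<close> has degree minus the dimension of \<open>\<sigma>\<close>, the differential is
  the coboundary, and the product is the cup product: the product of the duals of \<open>\<sigma>\<close> and
  \<open>\<tau>\<close> is the dual of the simplex with front face \<open>\<sigma>\<close> and back face \<open>\<tau>\<close>, if there is one.
\<close>

definition tetra :: "(bit ^ face) dga" where
  "tetra = based_dga
     (\<lambda>\<sigma>. 1 - int (card (verts \<sigma>)))
     (\<lambda>\<sigma> \<tau>. if Max (verts \<sigma>) = Min (verts \<tau>) \<and> verts \<sigma> \<union> verts \<tau> \<noteq> {0..3}
            then axis (Face (verts \<sigma> \<union> verts \<tau>)) 1 else 0)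
     (\<Sum>j\<in>{0..3}. axis (Face {j}) 1)
     (\<lambda>\<sigma>. \<Sum>\<tau> | verts \<sigma> \<subset> verts \<tau> \<and> card (verts \<tau>) = card (verts \<sigma>) + 1. axis \<tau> 1)"

abbreviation vtx :: "nat \<Rightarrow> face" where "vtx j \<equiv> Face {j}"
abbreviation edge :: "nat \<Rightarrow> nat \<Rightarrow> face" where "edge i j \<equiv> Face {i, j}"
abbreviation tri :: "nat \<Rightarrow> nat \<Rightarrow> nat \<Rightarrow> face" where "tri i j l \<equiv> Face {i, j, l}"

inductive_set local_support ::
    "nat \<Rightarrow> nat \<Rightarrow> nat \<Rightarrow> (face list \<times> face \<times> face list \<times> face) set"
  for i j l :: nat where
  no_c: "(m, n) \<in> {(tri i j l, vtx l), (vtx i, tri i j l), (edge i j, edge j l)} \<Longrightarrow>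
    (replicate k (edge i l), m, [], n) \<in> local_support i j l"
| one_c_left: "(m, n) \<in> {(vtx i, edge i j), (edge i j, vtx j)} \<Longrightarrow>
    (replicate u (edge i j) @ [tri i j l] @ replicate v (edge i l), m, [], n) \<in> local_support i j l"
| one_c_right: "(m, n) \<in> {(vtx j, edge j l), (edge j l, vtx l)} \<Longrightarrow>
    (replicate u (edge i l) @ [tri i j l] @ replicate v (edge j l), m, [], n) \<in> local_support i j l"
| two_c:
    "(replicate u (edge i j) @ [tri i j l] @ replicate v (edge i l) @ [tri i j l] @ replicate w (edge j l),
      vtx j, [], vtx j) \<in> local_support i j l"

definition local_family :: "nat \<Rightarrow> nat \<Rightarrow> nat \<Rightarrow> (bit ^ face) family" where
  "local_family i j l = family_of_support (local_support i j l)"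

definition tetra_F :: "(bit ^ face) family" where
  "tetra_F as m bs n =
     local_family 0 1 2 as m bs n + local_family 0 1 3 as m bs n
     + local_family 0 2 3 as m bs n + local_family 1 2 3 as m bs n"


section \<open>Cohomology of the 2-sphere\<close>

datatype sphere_basis = Ee | Ss

instance sphere_basis :: finite
proof
  have "(UNIV :: sphere_basis set) \<subseteq> {Ee, Ss}"
  proof
    fix x :: sphere_basis
    show "x \<in> {Ee, Ss}" by (cases x) simp_all
  qed
  then show "finite (UNIV :: sphere_basis set)" by (rule finite_subset) simp
qed

fun sphere_mul :: "sphere_basis \<Rightarrow> sphere_basis \<Rightarrow> bit ^ sphere_basis" where
  "sphere_mul Ee \<beta> = axis \<beta> 1"
| "sphere_mul \<alpha> Ee = axis \<alpha> 1"
| "sphere_mul Ss Ss = 0"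

definition sphere_cohom :: "(bit ^ sphere_basis) dga" where
  "sphere_cohom = based_dga (case_sphere_basis 0 (-2)) sphere_mul (axis Ee 1) (\<lambda>\<alpha>. 0)"

definition sphere_F :: "(bit ^ sphere_basis) family" where
  "sphere_F = family_of_support
     {([], Ss, [], Ee), ([], Ee, [], Ss), ([Ss, Ss], Ee, [], Ee)}"

definition sphere_to_tetra :: "bit ^ sphere_basis \<Rightarrow> bit ^ face" where
  "sphere_to_tetra x =
     x $ Ee *s (axis (vtx 0) 1 + axis (vtx 1) 1 + axis (vtx 2) 1 + axis (vtx 3) 1)
     + x $ Ss *s axis (tri 0 1 2) 1"

end

theory Submission
  imports Defs
begin

text \<open>
  All the families in question have the form \<open>F\<^sub>p\<^sub>,\<^sub>0(as; m)(n) = g(as)(m n)\<close>, so by associativity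
  the terms of \<open>\<D>F\<close> in which \<open>bs\<close> is contracted cancel in pairs, and \<open>\<D>F = 0\<close> becomes a
  Hochschild cocycle condition on \<open>g\<close>. For a triangle \<open>ijl\<close> the values of \<open>g\<close> are, up to
  coordinates of \<open>m n\<close>, entries of the product over the letters \<open>a\<close> of \<open>as\<close> of the upper triangular
  matrices with diagonal \<open>(a\<^sub>i\<^sub>j, a\<^sub>i\<^sub>l, a\<^sub>j\<^sub>l)\<close> and superdiagonal \<open>(a\<^sub>i\<^sub>j\<^sub>l, a\<^sub>i\<^sub>j\<^sub>l)\<close>. By induction on
  \<open>as\<close>, the cocycle defect of one triangle is the sum over its edges \<open>\<epsilon>\<close> of the product of all
  \<open>\<epsilon>\<close>-coordinates; every edge of the tetrahedron lies in two triangles, so the four defects cancel.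
\<close>

text \<open>\<^theory>\<open>HOL-Library.Z2\<close> makes the simplifier turn \<open>+\<close> and \<open>*\<close> on bits into bit
  operations, which disables ring normalisation.\<close>

declare add_bit_eq_xor [simp del] mult_bit_eq_and [simp del] bit_not_zero_iff [simp del]

section \<open>Characteristic two, coordinate spaces and dg-algebras on a finite basis\<close>

lemma bit_add_self [simp]: "(x::bit) + x = 0" "x + (x + y) = y"
  by (cases x; simp)+

lemma bit_add_eq_0_iff: "(x::bit) + y = 0 \<longleftrightarrow> x = y"
  by (cases x; cases y) simp_all

lemma sum_of_bool_mem:
  fixes f :: "'a::finite \<Rightarrow> 'b::semiring_1"
  shows "(\<Sum>x\<in>UNIV. f x * of_bool (x \<in> P)) = sum f P"
  by simp

lemma linear_vec_vecI:
  fixes f :: "'k::field ^ 'm \<Rightarrow> 'k ^ 'n"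
  assumes "\<And>x y. f (x + y) = f x + f y" "\<And>c x. f (c *s x) = c *s f x"
  shows "Vector_Spaces.linear (*s) (*s) f"
  by (simp add: Vector_Spaces.linear_iff vec.vector_space_axioms assms)

lemma linear_vec_scalarI:
  fixes f :: "'k::field ^ 'm \<Rightarrow> 'k"
  assumes "\<And>x y. f (x + y) = f x + f y" "\<And>c x. f (c *s x) = c * f x"
  shows "Vector_Spaces.linear (*s) (*) f"
  by (simp add: Vector_Spaces.linear_iff vec.vector_space_axioms
      vector_space_over_itself.vector_space_axioms assms)

text \<open>Grading, degree and linearity axioms can be read off the structure constants.
  Associativity, the unit laws, \<open>d d = 0\<close> and Leibniz are hypotheses on all vectors
  rather than on basis vectors, since coordinate formulas for the product and the differential turn
  them into polynomial identities.\<close>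

lemma unital_dga_based_dgaI:
  fixes deg :: "'i::finite \<Rightarrow> int" and mb u db
  defines "D \<equiv> based_dga deg mb u db"
  assumes mb_deg: "\<And>\<alpha> \<beta> \<gamma>. mb \<alpha> \<beta> $ \<gamma> \<noteq> 0 \<Longrightarrow> deg \<gamma> = deg \<alpha> + deg \<beta>"
    and u_deg: "\<And>\<gamma>. u $ \<gamma> \<noteq> 0 \<Longrightarrow> deg \<gamma> = 0"
    and db_deg: "\<And>\<alpha> \<gamma>. db \<alpha> $ \<gamma> \<noteq> 0 \<Longrightarrow> deg \<gamma> = deg \<alpha> - 1"
    and assoc: "\<And>x y z. mul D (mul D x y) z = mul D x (mul D y z)"
    and units: "\<And>x. mul D u x = x" "\<And>x. mul D x u = x"
    and dd: "\<And>x. diff D (diff D x) = 0"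
    and leibniz: "\<And>x y. diff D (mul D x y) = mul D (diff D x) y + mul D x (diff D y)"
  shows "unital_dga D"
proof -
  have scl: "scl D = (*s)" and gr: "gr D i = {x. \<forall>\<alpha>. x $ \<alpha> \<noteq> 0 \<longrightarrow> deg \<alpha> = i}"
    and unit: "unit D = u"
    and mul: "mul D x y $ \<gamma> = (\<Sum>\<alpha>\<in>UNIV. \<Sum>\<beta>\<in>UNIV. x $ \<alpha> * y $ \<beta> * mb \<alpha> \<beta> $ \<gamma>)"
    and diff: "diff D x $ \<gamma> = (\<Sum>\<alpha>\<in>UNIV. x $ \<alpha> * db \<alpha> $ \<gamma>)" for i x y \<gamma>
    by (simp_all add: D_def based_dga_def)
  have direct_sum:
    "\<exists>!h :: int \<Rightarrow> bit ^ 'i. (\<forall>i. h i \<in> gr D i) \<and> finite {i. h i \<noteq> 0} \<and> x = (\<Sum>i | h i \<noteq> 0. h i)"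
    for x
  proof -
    \<comment> \<open>Only the component of degree \<open>deg \<alpha>\<close> can contribute to
      coordinate \<open>\<alpha>\<close>. This gives both existence and uniqueness of the
      decomposition.\<close>
    have sum_coord: "(\<Sum>i | h i \<noteq> 0. h i) $ \<alpha> = h (deg \<alpha>) $ \<alpha>"
      if "\<forall>i. h i \<in> gr D i" "finite {i. h i \<noteq> 0}" for h and \<alpha>
    proof -
      have "h i $ \<alpha> = (if i = deg \<alpha> then h (deg \<alpha>) $ \<alpha> else 0)" for i
        using that(1) by (auto simp: gr)
      then have "(\<Sum>i | h i \<noteq> 0. h i $ \<alpha>)
          = (\<Sum>i | h i \<noteq> 0. if i = deg \<alpha> then h (deg \<alpha>) $ \<alpha> else 0)"
        by (intro sum.cong refl) blast
      also have "\<dots> = h (deg \<alpha>) $ \<alpha>" using that(2) by simp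
      finally show ?thesis by simp
    qed
    define p where "p i = (\<chi> \<alpha>. if deg \<alpha> = i then x $ \<alpha> else 0)" for i
    have p_gr: "\<forall>i. p i \<in> gr D i" by (auto simp: gr p_def)
    have "{i. p i \<noteq> 0} \<subseteq> range deg"
    proof
      fix i assume "i \<in> {i. p i \<noteq> 0}"
      then obtain \<alpha> where "p i $ \<alpha> \<noteq> 0" by (auto simp: vec_eq_iff)
      then show "i \<in> range deg" by (cases "deg \<alpha> = i") (auto simp: p_def)
    qed
    then have p_fin: "finite {i. p i \<noteq> 0}" by (rule finite_subset) simp
    show ?thesis
    proof (rule ex1I[of _ p])
      show "(\<forall>i. p i \<in> gr D i) \<and> finite {i. p i \<noteq> 0} \<and> x = (\<Sum>i | p i \<noteq> 0. p i)"
      proof (intro conjI p_gr p_fin)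
        show "x = (\<Sum>i | p i \<noteq> 0. p i)"
          by (subst vec_eq_iff, simp only: sum_coord[OF p_gr p_fin]) (simp add: p_def)
      qed
    next
      fix h assume h: "(\<forall>i. h i \<in> gr D i) \<and> finite {i. h i \<noteq> 0} \<and> x = (\<Sum>i | h i \<noteq> 0. h i)"
      then have "x $ \<alpha> = h (deg \<alpha>) $ \<alpha>" for \<alpha>
        using sum_coord[of h \<alpha>] by simp
      moreover have "h i $ \<alpha> = 0" if "deg \<alpha> \<noteq> i" for i \<alpha>
        using h that by (auto simp: gr)
      ultimately show "h = p" by (auto simp: fun_eq_iff vec_eq_iff p_def)
    qed
  qed
  have mul_linear:
    "Vector_Spaces.linear (scl D) (scl D) (\<lambda>x. mul D x y)"
    "Vector_Spaces.linear (scl D) (scl D) (\<lambda>x. mul D y x)" for y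
    unfolding scl
    by (rule linear_vec_vecI;
        simp add: vec_eq_iff mul algebra_simps sum.distrib sum_distrib_left)+
  have diff_linear: "Vector_Spaces.linear (scl D) (scl D) (diff D)"
    unfolding scl
    by (rule linear_vec_vecI;
        simp add: vec_eq_iff diff algebra_simps sum.distrib sum_distrib_left)
  have mul_gr: "mul D x y \<in> gr D (i + j)" if "x \<in> gr D i" "y \<in> gr D j" for x y i j
  proof (unfold gr, safe)
    fix \<gamma> assume "mul D x y $ \<gamma> \<noteq> 0"
    then obtain \<alpha> \<beta> where "x $ \<alpha> * y $ \<beta> * mb \<alpha> \<beta> $ \<gamma> \<noteq> 0"
      unfolding mul by (meson sum.not_neutral_contains_not_neutral)
    then have "x $ \<alpha> \<noteq> 0" "y $ \<beta> \<noteq> 0" "mb \<alpha> \<beta> $ \<gamma> \<noteq> 0" by fastforce+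
    then show "deg \<gamma> = i + j" using that mb_deg unfolding gr by auto
  qed
  have diff_gr: "diff D x \<in> gr D (i - 1)" if "x \<in> gr D i" for x i
  proof (unfold gr, safe)
    fix \<gamma> assume "diff D x $ \<gamma> \<noteq> 0"
    then obtain \<alpha> where "x $ \<alpha> * db \<alpha> $ \<gamma> \<noteq> 0"
      unfolding diff by (meson sum.not_neutral_contains_not_neutral)
    then have "x $ \<alpha> \<noteq> 0" "db \<alpha> $ \<gamma> \<noteq> 0" by fastforce+
    then show "deg \<gamma> = i - 1" using that db_deg unfolding gr by auto
  qed
  have subspace: "module.subspace (scl D) (gr D i)" for i
    unfolding scl vec.subspace_def by (auto simp: gr) (metis add.right_neutral)
  have unit_gr: "unit D \<in> gr D 0" using u_deg by (simp add: unit gr)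
  have vector_space: "vector_space (scl D)" unfolding scl by (rule vec.vector_space_axioms)
  show ?thesis
    by (intro unital_dga.intro unital_dga_axioms.intro)
      (rule vector_space subspace direct_sum mul_linear mul_gr assoc units[folded unit] unit_gr
        diff_linear diff_gr dd leibniz | assumption)+
qed

section \<open>Homology classes and quasi-isomorphisms\<close>

lemma homologous_equiv:
  assumes "unital_dga D"
  shows "equiv (cycles D i) (homologous D i)"
proof -
  interpret unital_dga D by fact
  interpret d: Vector_Spaces.linear "scl D" "scl D" "diff D" by (rule diff_linear)
  have sub: "subspace (diff D ` gr D (i + 1))" by (rule d.subspace_image[OF gr_subspace])
  show ?thesis
  proof (rule equivI)
    show "refl_on (cycles D i) (homologous D i)"
      using subspace_0[OF sub] by (auto simp: refl_on_def homologous_def)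
    show "sym (homologous D i)"
    proof (rule symI, unfold homologous_def, clarify)
      fix x y z assume "x - y = diff D z" "z \<in> gr D (i + 1)"
      then have "- (x - y) \<in> diff D ` gr D (i + 1)" using subspace_neg[OF sub] by blast
      then show "y - x \<in> diff D ` gr D (i + 1)" by simp
    qed
    show "trans (homologous D i)"
    proof (rule transI)
      fix x y z assume xyz: "(x, y) \<in> homologous D i" "(y, z) \<in> homologous D i"
      then have "(x - y) + (y - z) \<in> diff D ` gr D (i + 1)"
        by (intro subspace_add[OF sub]) (simp_all add: homologous_def)
      then show "(x, z) \<in> homologous D i" using xyz by (simp add: homologous_def)
    qed
    show "homologous D i \<subseteq> cycles D i \<times> cycles D i" by (auto simp: homologous_def)
  qed
qed

text \<open>By linearity, two classes with the same image differ by a cycle whose image bounds, so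
  \<open>inj\<close> only has to treat a single cycle; \<open>surj\<close> asks for a preimage up to
  a boundary.\<close>

lemma dga_quasi_isoI:
  assumes f: "dga_map B A f"
    and inj: "\<And>i x. x \<in> cycles B i \<Longrightarrow> f x \<in> diff A ` gr A (i + 1) \<Longrightarrow> x \<in> diff B ` gr B (i + 1)"
    and surj: "\<And>i y. y \<in> cycles A i \<Longrightarrow> \<exists>x\<in>cycles B i. y - f x \<in> diff A ` gr A (i + 1)"
  shows "dga_quasi_iso B A f"
  unfolding dga_quasi_iso_def
proof (intro conjI allI f)
  fix i
  have B: "unital_dga B" and A: "unital_dga A" using f by (auto simp: dga_map_def)
  interpret B: unital_dga B by fact
  interpret A: unital_dga A by fact
  interpret f: Vector_Spaces.linear "scl B" "scl A" f using f by (simp add: dga_map_def)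
  note eqB = homologous_equiv[OF B, of i] and eqA = homologous_equiv[OF A, of i]
  have f_cyc: "f x \<in> cycles A i" if "x \<in> cycles B i" for x
  proof -
    have "diff A (f x) = f (diff B x)" using f by (simp add: dga_map_def)
    then show ?thesis using that f by (auto simp: dga_map_def cycles_def f.zero)
  qed
  have f_hom: "(f x, f y) \<in> homologous A i" if "(x, y) \<in> homologous B i" for x y
  proof -
    obtain z where z: "x - y = diff B z" "z \<in> gr B (i + 1)"
      using \<open>(x, y) \<in> homologous B i\<close> by (auto simp: homologous_def)
    have "f x - f y = f (x - y)" by (simp add: f.diff)
    also have "\<dots> = diff A (f z)" using f z by (simp add: dga_map_def)
    finally have "f x - f y = diff A (f z)" .
    moreover have "f z \<in> gr A (i + 1)" using f z by (auto simp: dga_map_def)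
    ultimately show ?thesis using that f_cyc by (auto simp: homologous_def)
  qed
  have f_hom_inj: "(x, y) \<in> homologous B i"
    if "x \<in> cycles B i" "y \<in> cycles B i" "(f x, f y) \<in> homologous A i" for x y
  proof -
    have "x - y \<in> cycles B i"
    proof -
      interpret d: Vector_Spaces.linear "scl B" "scl B" "diff B" by (rule B.diff_linear)
      show ?thesis
        using that B.subspace_diff[OF B.gr_subspace] by (auto simp: cycles_def d.diff)
    qed
    moreover have "f (x - y) \<in> diff A ` gr A (i + 1)"
      using that(3) by (simp add: homologous_def f.diff)
    ultimately show ?thesis using that inj by (auto simp: homologous_def)
  qed
  \<comment> \<open>\<open>homology_map\<close> saturates the image of a whole class. As
    \<open>f\<close> preserves the relation, all representatives land in the class of
    \<open>f x\<close>.\<close>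
  have map_class: "homology_map A i f (homologous B i `` {x}) = homologous A i `` {f x}"
    if "x \<in> cycles B i" for x
  proof -
    have xx: "(x, x) \<in> homologous B i" using that eqB by (auto simp: equiv_def refl_on_def)
    have "trans (homologous A i)" using eqA by (simp add: equiv_def)
    then have "(f x, y) \<in> homologous A i"
      if "(f x', y) \<in> homologous A i" "(x, x') \<in> homologous B i" for x' y
      using that f_hom by (blast dest: transD)
    then show ?thesis unfolding homology_map_def using f_hom xx by blast
  qed
  show "bij_betw (homology_map A i f) (homology B i) (homology A i)"
    unfolding bij_betw_def
  proof
    show "inj_on (homology_map A i f) (homology B i)"
    proof (rule inj_onI, unfold homology_def, elim quotientE, hypsubst)
      fix x y
      assume xy: "x \<in> cycles B i" "y \<in> cycles B i"
        and eq: "homology_map A i f (homologous B i `` {x}) = homology_map A i f (homologous B i `` {y})"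
      have "(f x, f y) \<in> homologous A i"
        using eq eq_equiv_class_iff[OF eqA] f_cyc xy by (simp add: map_class)
      then show "homologous B i `` {x} = homologous B i `` {y}"
        using f_hom_inj xy equiv_class_eq[OF eqB] by blast
    qed
    show "homology_map A i f ` homology B i = homology A i"
    proof (intro equalityI subsetI)
      fix Y assume "Y \<in> homology_map A i f ` homology B i"
      then obtain x where "x \<in> cycles B i" "Y = homologous A i `` {f x}"
        by (auto simp: homology_def map_class elim!: quotientE)
      then show "Y \<in> homology A i" using f_cyc by (simp add: homology_def quotientI)
    next
      fix Y assume "Y \<in> homology A i"
      then obtain y where y: "y \<in> cycles A i" "Y = homologous A i `` {y}"
        by (auto simp: homology_def elim: quotientE)
      then obtain x where x: "x \<in> cycles B i" "y - f x \<in> diff A ` gr A (i + 1)" using surj by blast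
      then have "(y, f x) \<in> homologous A i" using y f_cyc by (simp add: homologous_def)
      then have "Y = homology_map A i f (homologous B i `` {x})"
        using y x map_class equiv_class_eq[OF eqA] by simp
      then show "Y \<in> homology_map A i f ` homology B i"
        using x(1) by (simp add: homology_def quotientI)
    qed
  qed
qed

section \<open>Transfer along dg-algebra maps\<close>

lemma DF_transferred:
  assumes f: "dga_map B A f"
  shows "DF B (transferred f F) as m bs n = DF A F (map f as) (f m) (map f bs) (f n)"
proof -
  have fm: "f (mul B x y) = mul A (f x) (f y)" "f (diff B x) = diff A (f x)" for x y
    using f by (auto simp: dga_map_def)
  \<comment> \<open>The bound keeps \<open>k\<close> and \<open>k + 1\<close> inside the list, where
    \<open>map\<close> commutes with \<open>!\<close>.\<close>
  have contract: "map f (contract B k xs) = contract A k (map f xs)" if "k < length xs - 1" for k xs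
    using that by (simp add: contract_def fm take_map drop_map)
  have sums:
    "(\<Sum>k<length xs. G (map f (xs[k := diff B (xs ! k)])))
      = (\<Sum>k<length xs. G ((map f xs)[k := diff A (map f xs ! k)]))"
    "(\<Sum>k<length xs - 1. G (map f (contract B k xs)))
      = (\<Sum>k<length xs - 1. G (contract A k (map f xs)))" for G :: "'b list \<Rightarrow> bit" and xs
    by (auto intro!: sum.cong simp: map_update fm contract)
  show ?thesis
    unfolding DF_def transferred_def
    using sums(1)[of "\<lambda>xs. F xs (f m) (map f bs) (f n)" as]
      sums(1)[of "\<lambda>ys. F (map f as) (f m) ys (f n)" bs]
      sums(2)[of "\<lambda>xs. F xs (f m) (map f bs) (f n)" as]
      sums(2)[of "\<lambda>ys. F (map f as) (f m) ys (f n)" bs]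
    by (simp add: fm map_tl map_butlast hd_map last_map)
qed

text \<open>Gives the conditions for \<open>sphere_F\<close> without computing \<open>DF\<close>
  over the sphere, once \<open>sphere_F\<close> is known to be a transferred family.\<close>

lemma homotopy_inner_product_transferred:
  assumes f: "dga_map B A f" and F: "homotopy_inner_product A F"
  shows "homotopy_inner_product B (transferred f F)"
proof -
  have lin: "Vector_Spaces.linear (scl B) (scl A) f" and unit: "f (unit B) = unit A"
    and gr: "f ` gr B i \<subseteq> gr A i" for i
    using f by (auto simp: dga_map_def)
  have comp: "Vector_Spaces.linear (scl B) (*) (\<lambda>x. g (f x))"
    if "Vector_Spaces.linear (scl A) (*) g" for g :: "'b \<Rightarrow> bit"
    using Vector_Spaces.linear_compose[OF lin that] by (simp add: comp_def)
  have mult: "multilinear_family A F" using F by (simp add: homotopy_inner_product_def)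
  have "transferred f F as m bs \<in> graded_dual B" for as m bs
  proof -
    have G: "F (map f as) (f m) (map f bs) \<in> graded_dual A"
      using mult by (simp add: multilinear_family_def)
    \<comment> \<open>Since \<open>f\<close> preserves degrees, the pulled-back functional is
      non-zero only in degrees where the original one is.\<close>
    have "{i. \<exists>n\<in>gr B i. F (map f as) (f m) (map f bs) (f n) \<noteq> 0}
        \<subseteq> {i. \<exists>n\<in>gr A i. F (map f as) (f m) (map f bs) n \<noteq> 0}"
      using gr by blast
    then have "finite {i. \<exists>n\<in>gr B i. F (map f as) (f m) (map f bs) (f n) \<noteq> 0}"
      by (rule finite_subset) (use G in \<open>simp add: graded_dual_def\<close>)
    moreover have "Vector_Spaces.linear (scl B) (*) (\<lambda>n. F (map f as) (f m) (map f bs) (f n))"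
      by (rule comp) (use G in \<open>simp add: graded_dual_def\<close>)
    ultimately show ?thesis by (simp add: graded_dual_def transferred_def[abs_def])
  qed
  moreover have "Vector_Spaces.linear (scl B) (*) (\<lambda>x. F (map f (as[k := x])) (f m) (map f bs) (f n))"
    if "k < length as" for as m bs n k
    unfolding map_update by (rule comp) (use mult that in \<open>simp add: multilinear_family_def\<close>)
  moreover have "Vector_Spaces.linear (scl B) (*) (\<lambda>x. F (map f as) (f m) (map f (bs[k := x])) (f n))"
    if "k < length bs" for as m bs n k
    unfolding map_update by (rule comp) (use mult that in \<open>simp add: multilinear_family_def\<close>)
  moreover have "Vector_Spaces.linear (scl B) (*) (\<lambda>m. F (map f as) (f m) (map f bs) (f n))"
    for as bs n
    by (rule comp) (use mult in \<open>simp add: multilinear_family_def\<close>)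
  ultimately have "multilinear_family B (transferred f F)"
    by (simp add: multilinear_family_def transferred_def)
  moreover have "transferred f F as m bs n = 0" if "unit B \<in> set as \<union> set bs" for as m bs n
  proof -
    have "unit A \<in> set (map f as) \<union> set (map f bs)" using that unit by (auto simp flip: unit)
    then show ?thesis using F by (simp only: homotopy_inner_product_def transferred_def)
  qed
  ultimately show ?thesis
    using F by (simp add: homotopy_inner_product_def DF_transferred[OF f])
qed

section \<open>Multilinear families\<close>

text \<open>The multilinear extension of a function on words of basis indices, written recursively
  so that it can be evaluated by induction on the list of vectors.\<close>

fun word_sum :: "('i::finite list \<Rightarrow> bit) \<Rightarrow> (bit ^ 'i) list \<Rightarrow> bit" where
  "word_sum g [] = g []"
| "word_sum g (a # as) = (\<Sum>\<sigma>\<in>UNIV. a $ \<sigma> * word_sum (\<lambda>\<alpha>. g (\<sigma> # \<alpha>)) as)"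

lemma word_sum_eq:
  "word_sum g as = (\<Sum>\<alpha> | length \<alpha> = length as. (\<Prod>k<length as. as ! k $ \<alpha> ! k) * g \<alpha>)"
proof (induction as arbitrary: g)
  case (Cons a as)
  have lists: "{\<alpha> :: 'a list. length \<alpha> = Suc (length as)}
      = (\<lambda>(\<sigma>, \<alpha>). \<sigma> # \<alpha>) ` (UNIV \<times> {\<alpha>. length \<alpha> = length as})"
    by (auto simp: length_Suc_conv image_iff)
  have inj: "inj_on (\<lambda>(\<sigma>, \<alpha>). \<sigma> # \<alpha>) (UNIV \<times> {\<alpha> :: 'a list. length \<alpha> = length as})"
    by (auto simp: inj_on_def)
  show ?case
    by (simp add: lists sum.reindex[OF inj, unfolded case_prod_unfold] Cons.IH
        prod.lessThan_Suc_shift sum_distrib_left mult.assoc sum.cartesian_product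
        case_prod_unfold del: prod.lessThan_Suc)
qed simp

lemma word_sum_zero [simp]: "word_sum (\<lambda>_. 0) as = 0"
  by (induction as) simp_all

lemma word_sum_add: "word_sum (\<lambda>\<alpha>. g \<alpha> + h \<alpha>) as = word_sum g as + word_sum h as"
  by (simp add: word_sum_eq algebra_simps sum.distrib)

lemma word_sum_cmul: "word_sum (\<lambda>\<alpha>. c * g \<alpha>) as = c * word_sum g as"
  by (simp add: word_sum_eq sum_distrib_left mult_ac)

lemma word_sum_update_linear:
  assumes "k < length as"
  shows "word_sum g (as[k := x + y]) = word_sum g (as[k := x]) + word_sum g (as[k := y])"
    and "word_sum g (as[k := c *s x]) = c * word_sum g (as[k := x])"
  using assms
  by (induction as arbitrary: g k)
    (auto split: nat.split simp: algebra_simps sum.distrib sum_distrib_left)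

lemma family_of_support_word_sum:
  "family_of_support S as m bs n =
     word_sum (\<lambda>\<alpha>. \<Sum>\<mu>\<in>UNIV. m $ \<mu> * word_sum (\<lambda>\<beta>. \<Sum>\<nu>\<in>UNIV. n $ \<nu> * of_bool ((\<alpha>, \<mu>, \<beta>, \<nu>) \<in> S)) bs) as"
  unfolding family_of_support_def word_sum_eq by (simp only: sum_distrib_left mult_ac)

lemma multilinear_family_of_support:
  fixes S :: "('i::finite list \<times> 'i \<times> 'i list \<times> 'i) set"
  shows "multilinear_family (based_dga deg mb u db) (family_of_support S)"
proof -
  let ?D = "based_dga deg mb u db"
  have scl: "scl ?D = (*s)" by (simp add: based_dga_def)
  have "family_of_support S as m bs \<in> graded_dual ?D" for as m bs
  proof -
    \<comment> \<open>A homogeneous \<open>n \<noteq> 0\<close> has the degree of some basis vector,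
      and there are finitely many of these.\<close>
    have "{i. \<exists>n\<in>gr ?D i. family_of_support S as m bs n \<noteq> 0} \<subseteq> range deg"
    proof clarify
      fix i n assume n: "n \<in> gr ?D i" and "family_of_support S as m bs n \<noteq> 0"
      then have "n \<noteq> 0" by (auto simp: family_of_support_def)
      then obtain \<nu> where "n $ \<nu> \<noteq> 0" by (auto simp: vec_eq_iff)
      then show "i \<in> range deg" using n by (auto simp: based_dga_def)
    qed
    then have "finite {i. \<exists>n\<in>gr ?D i. family_of_support S as m bs n \<noteq> 0}"
      by (rule finite_subset) simp
    moreover have "Vector_Spaces.linear (*s) (*) (family_of_support S as m bs)"
      by (rule linear_vec_scalarI)
        (simp_all add: family_of_support_def algebra_simps sum.distrib sum_distrib_left)
    ultimately show ?thesis by (simp add: graded_dual_def scl)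
  qed
  moreover have "Vector_Spaces.linear (*s) (*) (\<lambda>m. family_of_support S as m bs n)" for as bs n
    by (rule linear_vec_scalarI)
      (simp_all add: family_of_support_def algebra_simps sum.distrib sum_distrib_left)
  moreover have "Vector_Spaces.linear (*s) (*) (\<lambda>x. family_of_support S (as[k := x]) m bs n)"
    if "k < length as" for as m bs n k
    by (rule linear_vec_scalarI)
      (simp_all add: family_of_support_word_sum word_sum_update_linear[OF that])
  moreover have "Vector_Spaces.linear (*s) (*) (\<lambda>x. family_of_support S as m (bs[k := x]) n)"
    if "k < length bs" for as m bs n k
    by (rule linear_vec_scalarI)
      (simp_all add: family_of_support_word_sum word_sum_update_linear[OF that]
        distrib_left mult.left_commute[of _ c for c] sum.distrib word_sum_add word_sum_cmul
        flip: sum_distrib_left)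
  ultimately show ?thesis by (simp add: multilinear_family_def scl)
qed

lemma multilinear_family_add:
  fixes F G :: "(bit ^ 'i::finite) family"
  assumes scl: "scl D = (*s)" and "multilinear_family D F" "multilinear_family D G"
  shows "multilinear_family D (\<lambda>as m bs n. F as m bs n + G as m bs n)"
proof -
  have add: "Vector_Spaces.linear (*s) (*) (\<lambda>x. f x + g x)"
    if "Vector_Spaces.linear (*s) (*) f" "Vector_Spaces.linear (*s) (*) g"
    for f g :: "bit ^ 'i \<Rightarrow> bit"
    using that by (simp add: Vector_Spaces.linear_iff algebra_simps)
  have "(\<lambda>n. \<phi> n + \<psi> n) \<in> graded_dual D"
    if "\<phi> \<in> graded_dual D" "\<psi> \<in> graded_dual D" for \<phi> \<psi>
  proof -
    have "{i. \<exists>n\<in>gr D i. \<phi> n + \<psi> n \<noteq> 0}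
        \<subseteq> {i. \<exists>n\<in>gr D i. \<phi> n \<noteq> 0} \<union> {i. \<exists>n\<in>gr D i. \<psi> n \<noteq> 0}"
      by auto
    then have "finite {i. \<exists>n\<in>gr D i. \<phi> n + \<psi> n \<noteq> 0}"
      by (rule finite_subset) (use that in \<open>simp add: graded_dual_def\<close>)
    then show ?thesis using that add by (simp add: graded_dual_def scl)
  qed
  then show ?thesis using assms add by (simp add: multilinear_family_def)
qed

section \<open>Cochains of the tetrahedron\<close>

lemma verts_Face [simp]: "S \<noteq> {} \<Longrightarrow> S \<subset> {0..3} \<Longrightarrow> verts (Face S) = S"
  by (simp add: Face_inverse)

text \<open>Three indices cannot exhaust the four vertices. Repeated indices are allowed, so edges
  and vertices are the degenerate instances used in the next two lemmas.\<close>

lemma verts_tri [simp]: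
  assumes "i \<le> 3" "j \<le> 3" "l \<le> 3"
  shows "verts (tri i j l) = {i, j, l}"
proof (rule verts_Face)
  have "card {i, j, l} \<le> 3" by (simp add: card_insert_if)
  then have "{i, j, l} \<noteq> {0..3}" by (metis card_atLeastAtMost diff_zero not_less_eq_eq numeral_3_eq_3 order_refl)
  then show "{i, j, l} \<subset> {0..3}" using assms by auto
qed simp

lemma verts_edge [simp]: "i \<le> 3 \<Longrightarrow> j \<le> 3 \<Longrightarrow> verts (edge i j) = {i, j}"
  using verts_tri[of i j j] by simp

lemma verts_vtx [simp]: "i \<le> 3 \<Longrightarrow> verts (vtx i) = {i}"
  using verts_edge[of i i] by simp

lemma verts_subset: "verts \<sigma> \<subseteq> {0..3}" "verts \<sigma> \<noteq> {0..3}" "verts \<sigma> \<noteq> {}" "verts \<sigma> \<subset> {0..3}"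
  using verts[of \<sigma>] by auto

lemma finite_verts [simp]: "finite (verts \<sigma>)"
  using verts_subset(1) finite_subset by blast

text \<open>Peeling off the least element repeatedly lists the vertices of a face in increasing
  order; \<open>face_cases\<close> does this up to three times.\<close>

lemma Min_split:
  fixes S :: "nat set"
  assumes "finite S" "S \<noteq> {}"
  obtains i T where "S = insert i T" "\<And>t. t \<in> T \<Longrightarrow> i < t" "finite T"
proof (rule that[of "Min S" "S - {Min S}"])
  show "Min S < t" if "t \<in> S - {Min S}" for t
    using that assms Min_le[of S t] by (metis Diff_iff antisym_conv2 insertI1)
  show "S = insert (Min S) (S - {Min S})" using Min_in[OF assms] by blast
qed (use assms in simp)

lemma face_cases:
  obtains (vtx) i where "i \<le> 3" "\<sigma> = vtx i"
  | (edge) i j where "i < j" "j \<le> 3" "\<sigma> = edge i j"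
  | (tri) i j l where "i < j" "j < l" "l \<le> 3" "\<sigma> = tri i j l"
proof -
  have \<sigma>: "\<sigma> = Face (verts \<sigma>)" by (simp add: verts_inverse)
  obtain i T where i: "verts \<sigma> = insert i T" "\<And>t. t \<in> T \<Longrightarrow> i < t" "finite T"
    using Min_split[of "verts \<sigma>"] verts_subset finite_verts by metis
  show thesis
  proof (cases "T = {}")
    case True
    then show ?thesis using i \<sigma> verts_subset(1)[of \<sigma>] vtx[of i] by simp
  next
    case False
    then obtain j U where j: "T = insert j U" "\<And>t. t \<in> U \<Longrightarrow> j < t" "finite U"
      using Min_split i(3) by metis
    show ?thesis
    proof (cases "U = {}")
      case True
      then show ?thesis using i j \<sigma> verts_subset(1)[of \<sigma>] edge[of i j] by simp
    next
      case False
      then obtain l V where l: "U = insert l V" "\<And>t. t \<in> V \<Longrightarrow> l < t" "finite V"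
        using Min_split j(3) by metis
      \<comment> \<open>Four increasing vertices up to 3 would be all of \<open>{0..3}\<close>,
        which is not a face.\<close>
      have "V = {}"
      proof (rule ccontr)
        assume "V \<noteq> {}"
        then obtain r where r: "r \<in> V" by blast
        have "i < j" "j < l" "l < r" "r \<le> 3" using i j l r verts_subset(1)[of \<sigma>] by auto
        then have "i = 0" "j = 1" "l = 2" "r = 3" by auto
        then have "{0, 1, 2, 3} \<subseteq> verts \<sigma>" using i j l r by auto
        moreover have "{0..3} = {0, 1, 2, 3 :: nat}" by auto
        ultimately show False using verts_subset[of \<sigma>] by auto
      qed
      then show ?thesis using i j l \<sigma> verts_subset(1)[of \<sigma>] tri[of i j l] by simp
    qed
  qed
qed

text \<open>Reduces an equation of cochains to polynomial identities, one for each kind of simplex,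
  via the coordinate formulas below.\<close>

lemma face_vec_eqI:
  fixes x y :: "'b ^ face"
  assumes "\<And>i. i \<le> 3 \<Longrightarrow> x $ vtx i = y $ vtx i"
    and "\<And>i j. i < j \<Longrightarrow> j \<le> 3 \<Longrightarrow> x $ edge i j = y $ edge i j"
    and "\<And>i j l. i < j \<Longrightarrow> j < l \<Longrightarrow> l \<le> 3 \<Longrightarrow> x $ tri i j l = y $ tri i j l"
  shows "x = y"
proof (subst vec_eq_iff, rule allI)
  show "x $ \<sigma> = y $ \<sigma>" for \<sigma> by (cases \<sigma> rule: face_cases) (use assms in auto)
qed

lemma scl_tetra [simp]: "scl tetra = (*s)"
  and gr_tetra: "gr tetra i = {x. \<forall>\<sigma>. x $ \<sigma> \<noteq> 0 \<longrightarrow> 1 - int (card (verts \<sigma>)) = i}"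
  and unit_tetra: "unit tetra = (\<Sum>j\<in>{0..3}. axis (vtx j) 1)"
  by (simp_all add: tetra_def based_dga_def)

lemma gr_tetraI:
  assumes "\<And>p. p \<le> 3 \<Longrightarrow> x $ vtx p \<noteq> 0 \<Longrightarrow> i = 0"
    and "\<And>p q. p < q \<Longrightarrow> q \<le> 3 \<Longrightarrow> x $ edge p q \<noteq> 0 \<Longrightarrow> i = -1"
    and "\<And>p q r. p < q \<Longrightarrow> q < r \<Longrightarrow> r \<le> 3 \<Longrightarrow> x $ tri p q r \<noteq> 0 \<Longrightarrow> i = -2"
  shows "x \<in> gr tetra i"
proof (unfold gr_tetra, rule CollectI, rule allI, rule impI)
  show "1 - int (card (verts \<sigma>)) = i" if "x $ \<sigma> \<noteq> 0" for \<sigma>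
    by (cases \<sigma> rule: face_cases) (use assms that in \<open>auto simp: card_insert_if\<close>)
qed

text \<open>A splitting of \<open>\<rho>\<close> into a front and a back face is determined by the
  vertex \<open>v\<close> that they share.\<close>

lemma mul_tetra_nth:
  "mul tetra x y $ \<rho> =
     (\<Sum>v\<in>verts \<rho>. x $ Face {u\<in>verts \<rho>. u \<le> v} * y $ Face {u\<in>verts \<rho>. v \<le> u})"
proof -
  let ?P = "{(\<sigma>, \<tau>). Max (verts \<sigma>) = Min (verts \<tau>) \<and> verts \<sigma> \<union> verts \<tau> = verts \<rho>}"
  have coord: "(if Max (verts \<sigma>) = Min (verts \<tau>) \<and> verts \<sigma> \<union> verts \<tau> \<noteq> {0..3}
            then axis (Face (verts \<sigma> \<union> verts \<tau>)) (1::bit) else 0) $ \<rho>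
      = of_bool ((\<sigma>, \<tau>) \<in> ?P)" for \<sigma> \<tau>
  proof -
    have "Face (verts \<sigma> \<union> verts \<tau>) = \<rho> \<longleftrightarrow> verts \<sigma> \<union> verts \<tau> = verts \<rho>"
      if "verts \<sigma> \<union> verts \<tau> \<noteq> {0..3}"
    proof -
      have "verts (Face (verts \<sigma> \<union> verts \<tau>)) = verts \<sigma> \<union> verts \<tau>"
        using that verts_subset[of \<sigma>] verts_subset[of \<tau>] by (intro verts_Face) auto
      then show ?thesis by (metis verts_inject)
    qed
    then show ?thesis using verts_subset(2)[of \<rho>] by (auto simp: axis_def)
  qed
  have "mul tetra x y $ \<rho>
      = (\<Sum>\<sigma>\<in>UNIV. \<Sum>\<tau>\<in>UNIV. x $ \<sigma> * y $ \<tau> * of_bool ((\<sigma>, \<tau>) \<in> ?P))"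
    by (simp only: tetra_def based_dga_def dga.simps sum_component vector_smult_component coord)
  also have "\<dots> = (\<Sum>p\<in>UNIV. x $ fst p * y $ snd p * of_bool (p \<in> ?P))"
    by (simp only: sum.cartesian_product case_prod_unfold UNIV_Times_UNIV prod.collapse)
  also have "\<dots> = (\<Sum>p\<in>?P. x $ fst p * y $ snd p)"
    by (rule sum_of_bool_mem)
  also have "\<dots> = (\<Sum>v\<in>verts \<rho>. x $ Face {u\<in>verts \<rho>. u \<le> v} * y $ Face {u\<in>verts \<rho>. v \<le> u})"
  \<comment> \<open>The shared vertex is recovered as the last vertex of the front face.\<close>
  proof (rule sum.reindex_bij_witness[where
        i = "\<lambda>v. (Face {u\<in>verts \<rho>. u \<le> v}, Face {u\<in>verts \<rho>. v \<le> u})"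
        and j = "\<lambda>p. Max (verts (fst p))"])
    fix p assume "p \<in> ?P"
    then obtain \<sigma> \<tau> where p: "p = (\<sigma>, \<tau>)" "Max (verts \<sigma>) = Min (verts \<tau>)"
      "verts \<rho> = verts \<sigma> \<union> verts \<tau>" by auto
    let ?v = "Max (verts \<sigma>)"
    have \<sigma>: "?v \<in> verts \<sigma>" "\<And>u. u \<in> verts \<sigma> \<Longrightarrow> u \<le> ?v"
      using verts_subset(3) by simp_all
    have \<tau>: "?v \<in> verts \<tau>" "\<And>u. u \<in> verts \<tau> \<Longrightarrow> ?v \<le> u"
      using verts_subset(3)[of \<tau>] unfolding p(2) by simp_all
    have "{u\<in>verts \<rho>. u \<le> ?v} = verts \<sigma>" "{u\<in>verts \<rho>. ?v \<le> u} = verts \<tau>"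
      using \<sigma> \<tau> unfolding p(3) by (auto dest: antisym)
    then show pe: "(Face {u\<in>verts \<rho>. u \<le> Max (verts (fst p))}, Face {u\<in>verts \<rho>. Max (verts (fst p)) \<le> u}) = p"
      by (simp add: p verts_inverse)
    show "Max (verts (fst p)) \<in> verts \<rho>" using \<sigma> p by simp
    show "x $ Face {u\<in>verts \<rho>. u \<le> Max (verts (fst p))} * y $ Face {u\<in>verts \<rho>. Max (verts (fst p)) \<le> u}
        = x $ fst p * y $ snd p"
      using pe by (metis fst_conv snd_conv)
  next
    fix v assume v: "v \<in> verts \<rho>"
    have 1: "verts (Face {u\<in>verts \<rho>. u \<le> v}) = {u\<in>verts \<rho>. u \<le> v}"
      "verts (Face {u\<in>verts \<rho>. v \<le> u}) = {u\<in>verts \<rho>. v \<le> u}"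
      using v verts_subset[of \<rho>] by (intro verts_Face; blast)+
    have 2: "Max {u\<in>verts \<rho>. u \<le> v} = v" "Min {u\<in>verts \<rho>. v \<le> u} = v"
      using v by (auto intro!: Max_eqI Min_eqI)
    show "Max (verts (fst (Face {u\<in>verts \<rho>. u \<le> v}, Face {u\<in>verts \<rho>. v \<le> u}))) = v"
      using 1 2 by simp
    show "(Face {u\<in>verts \<rho>. u \<le> v}, Face {u\<in>verts \<rho>. v \<le> u}) \<in> ?P"
      using 1 2 by auto
  qed
  finally show ?thesis .
qed

text \<open>A face of codimension one is determined by the vertex left out. Vertices are treated
  separately because leaving out the only vertex gives the empty set, outside the domain where
  \<open>Face\<close> is meaningful.\<close>

lemma diff_tetra_nth:
  "diff tetra x $ \<rho> =
     (if card (verts \<rho>) = 1 then 0 else \<Sum>v\<in>verts \<rho>. x $ Face (verts \<rho> - {v}))"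
proof -
  let ?P = "{\<sigma>. verts \<sigma> \<subset> verts \<rho> \<and> card (verts \<rho>) = card (verts \<sigma>) + 1}"
  have "(\<Sum>\<tau> | verts \<sigma> \<subset> verts \<tau> \<and> card (verts \<tau>) = card (verts \<sigma>) + 1. axis \<tau> (1::bit)) $ \<rho>
      = of_bool (\<sigma> \<in> ?P)" for \<sigma>
    by (simp add: axis_def)
  then have "diff tetra x $ \<rho> = (\<Sum>\<sigma>\<in>UNIV. x $ \<sigma> * of_bool (\<sigma> \<in> ?P))"
    by (simp only: tetra_def based_dga_def dga.simps sum_component vector_smult_component)
  also have "\<dots> = (\<Sum>\<sigma>\<in>?P. x $ \<sigma>)"
    by (rule sum_of_bool_mem)
  also have "\<dots> = (if card (verts \<rho>) = 1 then 0 else \<Sum>v\<in>verts \<rho>. x $ Face (verts \<rho> - {v}))"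
  proof (cases "card (verts \<rho>) = 1")
    case True
    then have "?P = {}" using verts_subset(3) by auto
    then show ?thesis using True by (simp only: sum.empty if_True simp_thms)
  next
    case False
    have card_pos: "card (verts \<rho>) > 0" using verts_subset(3) by (simp add: card_gt_0_iff)
    have 1: "verts (Face (verts \<rho> - {v})) = verts \<rho> - {v}" if "v \<in> verts \<rho>" for v
    proof (rule verts_Face)
      show "verts \<rho> - {v} \<noteq> {}"
      proof
        assume "verts \<rho> - {v} = {}"
        then have "verts \<rho> = {v}" using that by auto
        then show False using False by simp
      qed
      show "verts \<rho> - {v} \<subset> {0..3}" using verts_subset[of \<rho>] by blast
    qed
    have "(\<Sum>\<sigma>\<in>?P. x $ \<sigma>) = (\<Sum>v\<in>verts \<rho>. x $ Face (verts \<rho> - {v}))"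
    proof (rule sum.reindex_bij_witness[where i = "\<lambda>v. Face (verts \<rho> - {v})"
          and j = "\<lambda>\<sigma>. the_elem (verts \<rho> - verts \<sigma>)"])
      fix \<sigma> assume "\<sigma> \<in> ?P"
      then have \<sigma>: "verts \<sigma> \<subset> verts \<rho>" "card (verts \<rho> - verts \<sigma>) = 1"
        by (auto simp: card_Diff_subset)
      then obtain v where v: "verts \<rho> - verts \<sigma> = {v}" by (auto simp: card_1_singleton_iff)
      then have "verts \<rho> - {v} = verts \<sigma>" "v \<in> verts \<rho>" using \<sigma>(1) by auto
      then show "Face (verts \<rho> - {the_elem (verts \<rho> - verts \<sigma>)}) = \<sigma>"
        "the_elem (verts \<rho> - verts \<sigma>) \<in> verts \<rho>"
        "x $ Face (verts \<rho> - {the_elem (verts \<rho> - verts \<sigma>)}) = x $ \<sigma>"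
        by (simp_all add: v verts_inverse)
    next
      fix v assume v: "v \<in> verts \<rho>"
      then have "verts \<rho> - (verts \<rho> - {v}) = {v}" by auto
      then show "the_elem (verts \<rho> - verts (Face (verts \<rho> - {v}))) = v" by (simp add: 1[OF v])
      show "Face (verts \<rho> - {v}) \<in> ?P" using v card_pos by (auto simp: 1[OF v])
    qed
    then show ?thesis using False by simp
  qed
  finally show ?thesis .
qed

lemma mul_tetra_vtx: "i \<le> 3 \<Longrightarrow> mul tetra x y $ vtx i = x $ vtx i * y $ vtx i"
  by (simp add: mul_tetra_nth Collect_conv_if conj_commute cong: conj_cong)

lemma mul_tetra_edge:
  assumes "i < j" "j \<le> 3"
  shows "mul tetra x y $ edge i j = x $ vtx i * y $ edge i j + x $ edge i j * y $ vtx j"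
proof -
  have "{u \<in> {i, j}. u \<le> i} = {i}" "{u \<in> {i, j}. i \<le> u} = {i, j}"
    "{u \<in> {i, j}. u \<le> j} = {i, j}" "{u \<in> {i, j}. j \<le> u} = {j}"
    using assms by auto
  then show ?thesis using assms by (simp add: mul_tetra_nth)
qed

lemma mul_tetra_tri:
  assumes "i < j" "j < l" "l \<le> 3"
  shows "mul tetra x y $ tri i j l =
    x $ vtx i * y $ tri i j l + x $ edge i j * y $ edge j l + x $ tri i j l * y $ vtx l"
proof -
  have "{u \<in> {i, j, l}. u \<le> i} = {i}" "{u \<in> {i, j, l}. i \<le> u} = {i, j, l}"
    "{u \<in> {i, j, l}. u \<le> j} = {i, j}" "{u \<in> {i, j, l}. j \<le> u} = {j, l}"
    "{u \<in> {i, j, l}. u \<le> l} = {i, j, l}" "{u \<in> {i, j, l}. l \<le> u} = {l}"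
    using assms by auto
  then show ?thesis using assms by (simp add: mul_tetra_nth add.assoc)
qed

lemma diff_tetra_vtx: "i \<le> 3 \<Longrightarrow> diff tetra x $ vtx i = 0"
  by (simp add: diff_tetra_nth)

lemma diff_tetra_edge:
  assumes "i < j" "j \<le> 3"
  shows "diff tetra x $ edge i j = x $ vtx i + x $ vtx j"
proof -
  have "{i, j} - {i} = {j}" "{i, j} - {j} = {i}" using assms by auto
  then show ?thesis using assms by (simp add: diff_tetra_nth add.commute)
qed

lemma diff_tetra_tri:
  assumes "i < j" "j < l" "l \<le> 3"
  shows "diff tetra x $ tri i j l = x $ edge i j + x $ edge i l + x $ edge j l"
proof -
  have "{i, j, l} - {i} = {j, l}" "{i, j, l} - {j} = {i, l}" "{i, j, l} - {l} = {i, j}"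
    using assms by auto
  then show ?thesis using assms by (simp add: diff_tetra_nth add_ac)
qed

lemmas tetra_coords =
  mul_tetra_vtx mul_tetra_edge mul_tetra_tri diff_tetra_vtx diff_tetra_edge diff_tetra_tri

lemma unit_tetra_nth: "unit tetra $ \<sigma> = of_bool (card (verts \<sigma>) = 1)"
proof -
  have "\<sigma> = vtx j \<longleftrightarrow> verts \<sigma> = {j}" if "j \<le> 3" for j
    using that verts_vtx verts_inject by metis
  then have "unit tetra $ \<sigma> = (\<Sum>j\<in>{0..3}. of_bool (verts \<sigma> = {j}))"
    by (auto simp: unit_tetra axis_def simp del: sum_of_bool_eq intro!: sum.cong)
  also have "\<dots> = of_bool (card (verts \<sigma>) = 1)"
  proof (cases "card (verts \<sigma>) = 1")
    case True
    then obtain i where i: "verts \<sigma> = {i}" by (auto simp: card_1_singleton_iff)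
    then have "i \<le> 3" using verts_subset(1)[of \<sigma>] by auto
    then show ?thesis by (simp add: i of_bool_def)
  next
    case False
    then have "verts \<sigma> \<noteq> {j}" for j by auto
    then show ?thesis using False by simp
  qed
  finally show ?thesis .
qed

lemma unit_tetra_coords:
  "i \<le> 3 \<Longrightarrow> unit tetra $ vtx i = 1"
  "i < j \<Longrightarrow> j \<le> 3 \<Longrightarrow> unit tetra $ edge i j = 0"
  "i < j \<Longrightarrow> j < l \<Longrightarrow> l \<le> 3 \<Longrightarrow> unit tetra $ tri i j l = 0"
  by (simp_all add: unit_tetra_nth)

lemma unital_dga_tetra: "unital_dga tetra"
proof -
  have u: "(\<Sum>j\<in>{0..3}. axis (vtx j) 1) = unit tetra" by (simp add: unit_tetra)
  show ?thesis
    unfolding tetra_def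
  proof (rule unital_dga_based_dgaI; (fold tetra_def)?; (unfold u)?)
    fix \<sigma> \<tau> \<rho>
    assume "(if Max (verts \<sigma>) = Min (verts \<tau>) \<and> verts \<sigma> \<union> verts \<tau> \<noteq> {0..3}
      then axis (Face (verts \<sigma> \<union> verts \<tau>)) (1::bit) else 0) $ \<rho> \<noteq> 0"
    then have *: "Max (verts \<sigma>) = Min (verts \<tau>)" "verts \<sigma> \<union> verts \<tau> \<noteq> {0..3}"
      "\<rho> = Face (verts \<sigma> \<union> verts \<tau>)"
      by (auto simp: axis_def split: if_splits)
    have \<rho>: "verts \<rho> = verts \<sigma> \<union> verts \<tau>"
      unfolding *(3) using *(2) verts_subset[of \<sigma>] verts_subset[of \<tau>] by (intro verts_Face) auto
    \<comment> \<open>Front and back face meet in exactly one vertex, so the cardinalities add up to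
      one more than that of the union, that is, the degrees add.\<close>
    have "verts \<sigma> \<inter> verts \<tau> = {Max (verts \<sigma>)}"
    proof (intro equalityI subsetI)
      fix v assume "v \<in> verts \<sigma> \<inter> verts \<tau>"
      then have "v \<le> Max (verts \<sigma>)" "Min (verts \<tau>) \<le> v" by simp_all
      then show "v \<in> {Max (verts \<sigma>)}" using *(1) by simp
    next
      have "Max (verts \<sigma>) \<in> verts \<sigma>" "Min (verts \<tau>) \<in> verts \<tau>"
        using verts_subset(3) by simp_all
      then show "v \<in> verts \<sigma> \<inter> verts \<tau>" if "v \<in> {Max (verts \<sigma>)}" for v using that *(1) by simp
    qed
    then have "card (verts \<sigma>) + card (verts \<tau>) = card (verts \<rho>) + 1"
      using card_Un_Int[of "verts \<sigma>" "verts \<tau>"] \<rho> by simp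
    then show "1 - int (card (verts \<rho>)) = 1 - int (card (verts \<sigma>)) + (1 - int (card (verts \<tau>)))"
      by simp
  next
    fix \<rho> assume "unit tetra $ \<rho> \<noteq> 0"
    then show "1 - int (card (verts \<rho>)) = 0" by (simp add: unit_tetra_nth)
  next
    fix \<sigma> \<rho>
    assume "(\<Sum>\<tau> | verts \<sigma> \<subset> verts \<tau> \<and> card (verts \<tau>) = card (verts \<sigma>) + 1. axis \<tau> (1::bit)) $ \<rho> \<noteq> 0"
    then obtain \<tau> where "card (verts \<tau>) = card (verts \<sigma>) + 1" "axis \<tau> (1::bit) $ \<rho> \<noteq> 0"
      unfolding sum_component by (auto dest: sum.not_neutral_contains_not_neutral)
    then show "1 - int (card (verts \<rho>)) = 1 - int (card (verts \<sigma>)) - 1"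
      by (auto simp: axis_def split: if_splits)
  \<comment> \<open>The four algebraic laws, coordinate by coordinate, as polynomial identities in
    characteristic two.\<close>
  qed (rule face_vec_eqI; simp add: tetra_coords unit_tetra_coords algebra_simps)+
qed

section \<open>The inner product of a triangle\<close>

text \<open>
  The three kinds of matrix entries: diagonal, and one and two steps above the diagonal.
\<close>

definition pow_weight :: "'i::finite \<Rightarrow> (bit ^ 'i) list \<Rightarrow> bit" where
  "pow_weight p as = (\<Prod>a\<leftarrow>as. a $ p)"

fun one_weight :: "'i::finite \<Rightarrow> 'i \<Rightarrow> 'i \<Rightarrow> (bit ^ 'i) list \<Rightarrow> bit" where
  "one_weight p c q [] = 0"
| "one_weight p c q (a # as) = a $ p * one_weight p c q as + a $ c * pow_weight q as"

fun two_weight :: "'i::finite \<Rightarrow> 'i \<Rightarrow> 'i \<Rightarrow> 'i \<Rightarrow> (bit ^ 'i) list \<Rightarrow> bit" where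
  "two_weight p c q r [] = 0"
| "two_weight p c q r (a # as) = a $ p * two_weight p c q r as + a $ c * one_weight q c r as"

lemma pow_weight_simps [simp]:
  "pow_weight p [] = 1" "pow_weight p (a # as) = a $ p * pow_weight p as"
  by (simp_all add: pow_weight_def)

lemma pow_weight_append [simp]: "pow_weight p (as @ bs) = pow_weight p as * pow_weight p bs"
  by (simp add: pow_weight_def)

text \<open>The matrix product expanded at its last factor instead of its first; needed where the
  boundary splits off the last letter of the word.\<close>

lemma one_weight_snoc [simp]:
  "one_weight p c q (as @ [a]) = one_weight p c q as * a $ q + pow_weight p as * a $ c"
  by (induction as) (simp_all add: algebra_simps)

lemma two_weight_snoc [simp]:
  "two_weight p c q r (as @ [a]) = two_weight p c q r as * a $ r + one_weight p c q as * a $ c"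
  by (induction as) (simp_all add: algebra_simps)

section \<open>Index words and the weights they sum to\<close>

definition pow_words :: "'i \<Rightarrow> 'i list set" where
  "pow_words p = {replicate u p | u. True}"

definition one_words :: "'i \<Rightarrow> 'i \<Rightarrow> 'i \<Rightarrow> 'i list set" where
  "one_words p c q = {replicate u p @ [c] @ replicate v q | u v. True}"

definition two_words :: "'i \<Rightarrow> 'i \<Rightarrow> 'i \<Rightarrow> 'i \<Rightarrow> 'i list set" where
  "two_words p c q r =
     {replicate u p @ [c] @ replicate v q @ [c] @ replicate w r | u v w. True}"

lemma Nil_mem_words [simp]:
  "[] \<in> pow_words p" "[] \<notin> one_words p c q" "[] \<notin> two_words p c q r"
  by (auto simp: pow_words_def one_words_def two_words_def)

lemma Cons_eq_replicate_append:
  "x # xs = replicate u p @ ys \<longleftrightarrow>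
     u = 0 \<and> x # xs = ys \<or> (\<exists>u'. u = Suc u' \<and> x = p \<and> xs = replicate u' p @ ys)"
  by (cases u) auto

lemma Cons_mem_words:
  "x # xs \<in> pow_words p \<longleftrightarrow> x = p \<and> xs \<in> pow_words p"
  "x # xs \<in> one_words p c q \<longleftrightarrow> x = p \<and> xs \<in> one_words p c q \<or> x = c \<and> xs \<in> pow_words q"
  "x # xs \<in> two_words p c q r \<longleftrightarrow> x = p \<and> xs \<in> two_words p c q r \<or> x = c \<and> xs \<in> one_words q c r"
proof -
  show "x # xs \<in> pow_words p \<longleftrightarrow> x = p \<and> xs \<in> pow_words p"
    using Cons_eq_replicate_append[of x xs _ p "[]"] by (auto simp: pow_words_def)
qed (auto simp: pow_words_def one_words_def two_words_def Cons_eq_replicate_append; metis)+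

lemma sum_letter: "(\<Sum>\<sigma>\<in>UNIV. a $ \<sigma> * (of_bool (\<sigma> = p) * x)) = a $ p * (x::bit)"
  for a :: "bit ^ 'i::finite"
proof -
  have "a $ \<sigma> * (of_bool (\<sigma> = p) * x) = (if \<sigma> = p then a $ p * x else 0)" for \<sigma> by simp
  then show ?thesis by simp
qed

text \<open>The hypothesis \<open>p \<noteq> c\<close> makes the two alternatives exclusive;
  otherwise the sum of their indicators could be \<open>1 + 1 = 0\<close>.\<close>

lemma word_sum_step:
  assumes "p \<noteq> c" and L: "\<And>\<sigma> \<alpha>. \<sigma> # \<alpha> \<in> L \<longleftrightarrow> \<sigma> = p \<and> \<alpha> \<in> L1 \<or> \<sigma> = c \<and> \<alpha> \<in> L2"
  shows "word_sum (\<lambda>\<alpha>. of_bool (\<alpha> \<in> L)) (a # as) =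
    a $ p * word_sum (\<lambda>\<alpha>. of_bool (\<alpha> \<in> L1)) as + a $ c * word_sum (\<lambda>\<alpha>. of_bool (\<alpha> \<in> L2)) as"
proof -
  have "of_bool (\<sigma> # \<alpha> \<in> L) = of_bool (\<sigma> = p) * of_bool (\<alpha> \<in> L1) + of_bool (\<sigma> = c) * (of_bool (\<alpha> \<in> L2) :: bit)"
    for \<sigma> \<alpha> using assms by (auto simp: L)
  then show ?thesis
    by (simp only: word_sum.simps word_sum_add word_sum_cmul distrib_left sum.distrib sum_letter)
qed

text \<open>Expanding a matrix entry gives one monomial per path, which stays on the diagonal or
  steps by the letter \<open>c\<close>; the words record these paths. Splitting off the first letter
  gives the same recursion on both sides.\<close>

lemma word_sum_words:
  "word_sum (\<lambda>\<alpha>. of_bool (\<alpha> \<in> pow_words p)) as = pow_weight p as"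
  "p \<noteq> c \<Longrightarrow> word_sum (\<lambda>\<alpha>. of_bool (\<alpha> \<in> one_words p c q)) as = one_weight p c q as"
  "p \<noteq> c \<Longrightarrow> q \<noteq> c \<Longrightarrow>
    word_sum (\<lambda>\<alpha>. of_bool (\<alpha> \<in> two_words p c q r)) as = two_weight p c q r as"
proof -
  show pow: "word_sum (\<lambda>\<alpha>. of_bool (\<alpha> \<in> pow_words p)) as = pow_weight p as" for p as
    by (induction as)
      (simp_all add: Cons_mem_words of_bool_conj word_sum_cmul sum_letter del: of_bool_eq_iff)
  show one: "word_sum (\<lambda>\<alpha>. of_bool (\<alpha> \<in> one_words p c q)) as = one_weight p c q as"
    if "p \<noteq> c" for p q as
    by (induction as)
      (simp_all add: word_sum_step[OF that Cons_mem_words(2)] pow del: word_sum.simps(2))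
  show "word_sum (\<lambda>\<alpha>. of_bool (\<alpha> \<in> two_words p c q r)) as = two_weight p c q r as"
    if "p \<noteq> c" "q \<noteq> c"
    by (induction as)
      (simp_all add: word_sum_step[OF that(1) Cons_mem_words(3)] one[OF that(2)] del: word_sum.simps(2))
qed

text \<open>The bar differential, without the two terms in which an end of the word acts on the
  argument of the form.\<close>

definition bar :: "'a dga \<Rightarrow> ('a list \<Rightarrow> bit) \<Rightarrow> 'a list \<Rightarrow> bit" where
  "bar D g as =
     (\<Sum>k<length as. g (as[k := diff D (as ! k)])) + (\<Sum>k<length as - 1. g (contract D k as))"

lemma bar_Nil [simp]: "bar D g [] = 0"
  by (simp add: bar_def)

text \<open>The recursion behind all inductions on words below: either the first letter is
  differentiated, or it is merged with the second, or the rest of the word is changed.\<close>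

lemma bar_Cons:
  "bar D g (a # as) = g (diff D a # as) + bar D (\<lambda>as. g (a # as)) as
     + (if as = [] then 0 else g (mul D a (hd as) # tl as))"
proof (cases as)
  case Nil
  then show ?thesis by (simp add: bar_def)
next
  case (Cons b bs)
  then show ?thesis
    by (simp add: bar_def contract_def sum.lessThan_Suc_shift add_ac del: sum.lessThan_Suc)
qed

lemma bar_linear:
  "bar D (\<lambda>as. g as + h as) as = bar D g as + bar D h as"
  "bar D (\<lambda>as. c * g as) as = c * bar D g as"
  "bar D (\<lambda>as. g as * c) as = bar D g as * c"
  by (simp_all add: bar_def sum.distrib algebra_simps sum_distrib_left)

text \<open>On the edge, \<open>d a\<close> is \<open>a $ vtx p + a $ vtx q\<close> and a product of
  neighbours \<open>a\<close>, \<open>b\<close> is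
  \<open>a $ vtx p * b $ edge p q + a $ edge p q * b $ vtx q\<close>. Each inner vertex term arises
  once from each source and cancels; one term at either end of the word survives.\<close>

lemma bar_pow_weight:
  assumes "p < q" "q \<le> 3"
  shows "bar tetra (pow_weight (edge p q)) as = (if as = [] then 0 else
    hd as $ vtx q * pow_weight (edge p q) (tl as) + pow_weight (edge p q) (butlast as) * last as $ vtx p)"
proof (induction as)
  case (Cons a as)
  show ?case
    by (simp only: bar_Cons pow_weight_simps bar_linear Cons.IH)
      (cases as; use assms in \<open>simp add: tetra_coords algebra_simps\<close>)
qed simp

context
  fixes i j l :: nat
  assumes ijl: "i < j" "j < l" "l \<le> 3"
begin

lemmas bar_pow_weight_edges =
  bar_pow_weight[OF ijl(1) order.trans[OF less_imp_le[OF ijl(2)] ijl(3)]]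
  bar_pow_weight[OF less_trans[OF ijl(1,2)] ijl(3)] bar_pow_weight[OF ijl(2,3)]

text \<open>Differentiating the triangle letter yields its three edges. Summed over the position of
  that letter, the \<open>edge i j\<close> and \<open>edge i l\<close> terms telescope to the two
  pure words, and the \<open>edge j l\<close> terms cancel against products of
  \<open>edge i j\<close> with \<open>edge j l\<close>, except for the one at the head. Vertex terms
  cancel as in \<open>bar_pow_weight\<close>, up to the ends.\<close>

lemma bar_one_weight_left:
  "bar tetra (one_weight (edge i j) (tri i j l) (edge i l)) as =
     pow_weight (edge i j) as + pow_weight (edge i l) as + (if as = [] then 0 else
       one_weight (edge i j) (tri i j l) (edge i l) (tl as) * hd as $ vtx j
       + pow_weight (edge i l) (tl as) * hd as $ edge j l
       + one_weight (edge i j) (tri i j l) (edge i l) (butlast as) * last as $ vtx i)"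
proof (induction as)
  case (Cons a as)
  show ?case
    by (simp only: bar_Cons one_weight.simps bar_linear Cons.IH bar_pow_weight_edges)
      (cases as; use ijl in \<open>simp add: tetra_coords algebra_simps\<close>)
qed simp

text \<open>Mirror image of the previous case: now it is the \<open>edge i j\<close> term that
  survives, at the end of the word.\<close>

lemma bar_one_weight_right:
  "bar tetra (one_weight (edge i l) (tri i j l) (edge j l)) as =
     pow_weight (edge i l) as + pow_weight (edge j l) as + (if as = [] then 0 else
       one_weight (edge i l) (tri i j l) (edge j l) (tl as) * hd as $ vtx l
       + one_weight (edge i l) (tri i j l) (edge j l) (butlast as) * last as $ vtx j
       + pow_weight (edge i l) (butlast as) * last as $ edge i j)"
proof (induction as)
  case (Cons a as)
  show ?case
    by (simp only: bar_Cons one_weight.simps bar_linear Cons.IH bar_pow_weight_edges)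
      (cases as; use ijl in \<open>simp add: tetra_coords algebra_simps\<close>)
qed simp

text \<open>Replacing either triangle letter by an edge telescopes as before. Words consisting of a
  run of \<open>edge i j\<close>, one triangle letter and a run of \<open>edge j l\<close> arise
  from both replacements and cancel, leaving the two weights with one triangle letter.\<close>

lemma bar_two_weight:
  "bar tetra (two_weight (edge i j) (tri i j l) (edge i l) (edge j l)) as =
     one_weight (edge i j) (tri i j l) (edge i l) as
     + one_weight (edge i l) (tri i j l) (edge j l) as + (if as = [] then 0 else
       two_weight (edge i j) (tri i j l) (edge i l) (edge j l) (tl as) * hd as $ vtx j
       + one_weight (edge i l) (tri i j l) (edge j l) (tl as) * hd as $ edge j l
       + two_weight (edge i j) (tri i j l) (edge i l) (edge j l) (butlast as) * last as $ vtx j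
       + one_weight (edge i j) (tri i j l) (edge i l) (butlast as) * last as $ edge i j)"
proof (induction as)
  case (Cons a as)
  show ?case
    by (simp only: bar_Cons two_weight.simps bar_linear Cons.IH bar_one_weight_right)
      (cases as; use ijl in \<open>simp add: tetra_coords algebra_simps\<close>)
qed simp

end

section \<open>The local families as functions of the cup product\<close>

definition triangle_form :: "nat \<Rightarrow> nat \<Rightarrow> nat \<Rightarrow> (bit ^ face) list \<Rightarrow> bit ^ face \<Rightarrow> bit" where
  "triangle_form i j l as x =
     pow_weight (edge i l) as * x $ tri i j l
     + one_weight (edge i j) (tri i j l) (edge i l) as * x $ edge i j
     + one_weight (edge i l) (tri i j l) (edge j l) as * x $ edge j l
     + two_weight (edge i j) (tri i j l) (edge i l) (edge j l) as * x $ vtx j"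

lemma local_support_iff:
  "(\<alpha>, \<mu>, \<beta>, \<nu>) \<in> local_support i j l \<longleftrightarrow> \<beta> = [] \<and>
     (\<alpha> \<in> pow_words (edge i l)
        \<and> (\<mu>, \<nu>) \<in> {(tri i j l, vtx l), (vtx i, tri i j l), (edge i j, edge j l)}
      \<or> \<alpha> \<in> one_words (edge i j) (tri i j l) (edge i l)
        \<and> (\<mu>, \<nu>) \<in> {(vtx i, edge i j), (edge i j, vtx j)}
      \<or> \<alpha> \<in> one_words (edge i l) (tri i j l) (edge j l)
        \<and> (\<mu>, \<nu>) \<in> {(vtx j, edge j l), (edge j l, vtx l)}
      \<or> \<alpha> \<in> two_words (edge i j) (tri i j l) (edge i l) (edge j l) \<and> (\<mu>, \<nu>) = (vtx j, vtx j))"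
  unfolding local_support.simps pow_words_def one_words_def two_words_def
  by (rule iffI; elim disjE conjE exE; blast)

lemma distinct_faces:
  assumes "i < j" "j < l" "l \<le> 3"
  shows "distinct [vtx i, vtx j, vtx l, edge i j, edge i l, edge j l, tri i j l]"
proof -
  have "distinct (map verts [vtx i, vtx j, vtx l, edge i j, edge i l, edge j l, tri i j l])"
  proof -
    have "l \<notin> {i, j}" using assms by simp
    then have "{i, j} \<noteq> {i, j, l}" by blast
    then show ?thesis using assms by (auto simp: doubleton_eq_iff)
  qed
  then show ?thesis by (simp only: distinct_map)
qed

lemma sum_two_letters:
  fixes m n :: "bit ^ 'i::finite"
  shows "(\<Sum>\<mu>\<in>UNIV. m $ \<mu> * (\<Sum>\<nu>\<in>UNIV. n $ \<nu> * (of_bool (\<mu> = p) * (of_bool (\<nu> = q) * x))))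
    = m $ p * (n $ q * x)"
proof -
  have "(\<Sum>\<nu>\<in>UNIV. n $ \<nu> * (of_bool (\<mu> = p) * (of_bool (\<nu> = q) * x)))
      = of_bool (\<mu> = p) * (n $ q * x)" for \<mu>
    by (simp only: sum_letter mult.left_commute[of "n $ _" "of_bool (\<mu> = p)"] flip: sum_distrib_left)
  then show ?thesis by (simp only: sum_letter)
qed

text \<open>The eight pairs are distinct, so at most one summand is non-zero and the indicator of
  the disjunction is a sum even in characteristic two. Abstract letters and propositions keep the
  case analysis free of faces and words.\<close>

lemma of_bool_pair_table:
  assumes "distinct [vi, vj, vl, eij, ejl, t]"
  shows "(of_bool (A \<and> (\<mu>, \<nu>) \<in> {(t, vl), (vi, t), (eij, ejl)}
      \<or> B \<and> (\<mu>, \<nu>) \<in> {(vi, eij), (eij, vj)}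
      \<or> C \<and> (\<mu>, \<nu>) \<in> {(vj, ejl), (ejl, vl)}
      \<or> E \<and> (\<mu>, \<nu>) = (vj, vj)) :: bit) =
      of_bool (\<mu> = t) * (of_bool (\<nu> = vl) * of_bool A)
    + of_bool (\<mu> = vi) * (of_bool (\<nu> = t) * of_bool A)
    + of_bool (\<mu> = eij) * (of_bool (\<nu> = ejl) * of_bool A)
    + of_bool (\<mu> = vi) * (of_bool (\<nu> = eij) * of_bool B)
    + of_bool (\<mu> = eij) * (of_bool (\<nu> = vj) * of_bool B)
    + of_bool (\<mu> = vj) * (of_bool (\<nu> = ejl) * of_bool C)
    + of_bool (\<mu> = ejl) * (of_bool (\<nu> = vl) * of_bool C)
    + of_bool (\<mu> = vj) * (of_bool (\<nu> = vj) * of_bool E)"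
proof -
  \<comment> \<open>The reversed list supplies every inequality in the other orientation for the
    simplifier.\<close>
  have rev: "distinct [t, ejl, eij, vl, vj, vi]"
    using iffD2[OF distinct_rev assms] by simp
  note neq = assms[simplified] rev[simplified]
  consider "\<mu> = vi" | "\<mu> = vj" | "\<mu> = eij" | "\<mu> = ejl" | "\<mu> = t" | "\<mu> \<notin> {vi, vj, eij, ejl, t}"
    by blast
  then show ?thesis
  proof cases
    case 1
    then show ?thesis by (cases "\<nu> = t"; cases "\<nu> = eij"; simp add: neq)
  next
    case 2
    then show ?thesis by (cases "\<nu> = ejl"; cases "\<nu> = vj"; simp add: neq)
  next
    case 3
    then show ?thesis by (cases "\<nu> = ejl"; cases "\<nu> = vj"; simp add: neq)
  next
    case 4
    then show ?thesis by (cases "\<nu> = vl"; simp add: neq)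
  next
    case 5
    then show ?thesis by (cases "\<nu> = vl"; simp add: neq)
  next
    case 6
    then show ?thesis by simp
  qed
qed

lemma of_bool_local_support:
  assumes "i < j" "j < l" "l \<le> 3"
  shows "(of_bool ((\<alpha>, \<mu>, [], \<nu>) \<in> local_support i j l) :: bit) =
      of_bool (\<mu> = tri i j l) * (of_bool (\<nu> = vtx l) * of_bool (\<alpha> \<in> pow_words (edge i l)))
    + of_bool (\<mu> = vtx i) * (of_bool (\<nu> = tri i j l) * of_bool (\<alpha> \<in> pow_words (edge i l)))
    + of_bool (\<mu> = edge i j) * (of_bool (\<nu> = edge j l) * of_bool (\<alpha> \<in> pow_words (edge i l)))
    + of_bool (\<mu> = vtx i) * (of_bool (\<nu> = edge i j) * of_bool (\<alpha> \<in> one_words (edge i j) (tri i j l) (edge i l)))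
    + of_bool (\<mu> = edge i j) * (of_bool (\<nu> = vtx j) * of_bool (\<alpha> \<in> one_words (edge i j) (tri i j l) (edge i l)))
    + of_bool (\<mu> = vtx j) * (of_bool (\<nu> = edge j l) * of_bool (\<alpha> \<in> one_words (edge i l) (tri i j l) (edge j l)))
    + of_bool (\<mu> = edge j l) * (of_bool (\<nu> = vtx l) * of_bool (\<alpha> \<in> one_words (edge i l) (tri i j l) (edge j l)))
    + of_bool (\<mu> = vtx j) * (of_bool (\<nu> = vtx j) * of_bool (\<alpha> \<in> two_words (edge i j) (tri i j l) (edge i l) (edge j l)))"
proof -
  have "distinct [vtx i, vtx j, vtx l, edge i j, edge j l, tri i j l]"
    using distinct_faces[OF assms] by simp
  from of_bool_pair_table[OF this] show ?thesis
    unfolding local_support_iff by (simp only: simp_thms)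
qed

text \<open>The pairs attached to one kind of word are exactly the front and back factorisations of
  one face: of the triangle for \<open>A\<close>, of its edges \<open>i j\<close> and
  \<open>j l\<close> for \<open>B\<close> and \<open>C\<close>, of the vertex \<open>j\<close> for
  \<open>E\<close>. Hence only the cup product of \<open>m\<close> and \<open>n\<close>
  matters.\<close>

lemma pair_products:
  fixes A B C E :: bit
  assumes "i < j" "j < l" "l \<le> 3"
  shows "m $ tri i j l * (n $ vtx l * A)
    + m $ vtx i * (n $ tri i j l * A)
    + m $ edge i j * (n $ edge j l * A)
    + m $ vtx i * (n $ edge i j * B)
    + m $ edge i j * (n $ vtx j * B)
    + m $ vtx j * (n $ edge j l * C)
    + m $ edge j l * (n $ vtx l * C)
    + m $ vtx j * (n $ vtx j * E)
    = (mul tetra m n $ tri i j l) * A + (mul tetra m n $ edge i j) * B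
      + (mul tetra m n $ edge j l) * C + (mul tetra m n $ vtx j) * E"
  using assms by (simp add: tetra_coords distrib_left distrib_right add_ac mult_ac)

lemma local_family_eq:
  assumes ijl: "i < j" "j < l" "l \<le> 3"
  shows "local_family i j l as m bs n =
    (if bs = [] then triangle_form i j l as (mul tetra m n) else 0)"
proof (cases bs)
  case Nil
  have "(\<Sum>\<mu>\<in>UNIV. m $ \<mu> * (\<Sum>\<nu>\<in>UNIV. n $ \<nu> * of_bool ((\<alpha>, \<mu>, [], \<nu>) \<in> local_support i j l))) =
      (mul tetra m n $ tri i j l) * of_bool (\<alpha> \<in> pow_words (edge i l))
    + (mul tetra m n $ edge i j) * of_bool (\<alpha> \<in> one_words (edge i j) (tri i j l) (edge i l))
    + (mul tetra m n $ edge j l) * of_bool (\<alpha> \<in> one_words (edge i l) (tri i j l) (edge j l))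
    + (mul tetra m n $ vtx j) * of_bool (\<alpha> \<in> two_words (edge i j) (tri i j l) (edge i l) (edge j l))"
    for \<alpha>
    unfolding of_bool_local_support[OF ijl]
    by (simp only: distrib_left sum.distrib sum_two_letters pair_products[OF ijl])
  then have "local_family i j l as m bs n =
      (mul tetra m n $ tri i j l) * word_sum (\<lambda>\<alpha>. of_bool (\<alpha> \<in> pow_words (edge i l))) as
    + (mul tetra m n $ edge i j) * word_sum (\<lambda>\<alpha>. of_bool (\<alpha> \<in> one_words (edge i j) (tri i j l) (edge i l))) as
    + (mul tetra m n $ edge j l) * word_sum (\<lambda>\<alpha>. of_bool (\<alpha> \<in> one_words (edge i l) (tri i j l) (edge j l))) as
    + (mul tetra m n $ vtx j) * word_sum (\<lambda>\<alpha>. of_bool (\<alpha> \<in> two_words (edge i j) (tri i j l) (edge i l) (edge j l))) as"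
    unfolding local_family_def family_of_support_word_sum Nil word_sum.simps(1)
    by (simp only: word_sum_add word_sum_cmul)
  also have "\<dots> = triangle_form i j l as (mul tetra m n)"
  proof -
    have "edge i j \<noteq> tri i j l" "edge i l \<noteq> tri i j l" using distinct_faces[OF ijl] by auto
    then show ?thesis by (simp only: word_sum_words triangle_form_def mult.commute not_False_eq_True)
  qed
  finally show ?thesis using Nil by (simp only: simp_thms if_True)
next
  case (Cons b bs')
  then show ?thesis
    by (simp add: local_family_def family_of_support_word_sum local_support_iff)
qed

lemma triangle_form_add:
  "triangle_form i j l as (x + y) = triangle_form i j l as x + triangle_form i j l as y"
  by (simp add: triangle_form_def algebra_simps)

section \<open>The cocycle condition\<close>

lemma DF_cyclic_family:
  assumes D: "unital_dga D"
    and F: "\<And>as m bs n. F as m bs n = (if bs = [] then g as (mul D m n) else 0)"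
    and g: "\<And>as x y. g as (x + y) = g as x + g as y"
  shows "DF D F as m bs n = (if bs \<noteq> [] then 0 else
    bar D (\<lambda>as. g as (mul D m n)) as + g as (diff D (mul D m n))
    + (if as = [] then 0
       else g (tl as) (mul D (mul D m n) (hd as)) + g (butlast as) (mul D (last as) (mul D m n))))"
proof -
  interpret unital_dga D by fact
  have contract: "contract D k bs \<noteq> []" for k bs by (simp add: contract_def)
  show ?thesis
  proof (cases bs)
    case Nil
    \<comment> \<open>The terms with \<open>d\<close> on \<open>m\<close> and on \<open>n\<close>
      combine to \<open>g as (diff D (mul D m n))\<close> by additivity and Leibniz.\<close>
    then show ?thesis by (simp add: DF_def F bar_def g leibniz mul_assoc algebra_simps)
  next
    case (Cons b bs')
    \<comment> \<open>If \<open>bs\<close> has one letter, its two outer actions give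
      \<open>g as\<close> at the same triple product and cancel. For longer \<open>bs\<close>, every
      term keeps a non-empty right-hand list and vanishes.\<close>
    then show ?thesis
      by (cases bs') (simp_all add: DF_def F contract mul_assoc del: list_update.simps)
  qed
qed

lemma triangle_form_boundary:
  assumes ijl: "i < j" "j < l" "l \<le> 3"
  shows "bar tetra (\<lambda>as. triangle_form i j l as x) as + triangle_form i j l as (diff tetra x)
      + (if as = [] then 0 else triangle_form i j l (tl as) (mul tetra x (hd as))
           + triangle_form i j l (butlast as) (mul tetra (last as) x))
    = pow_weight (edge i j) as * x $ edge i j + pow_weight (edge i l) as * x $ edge i l
      + pow_weight (edge j l) as * x $ edge j l"
proof -
  let ?P = "pow_weight (edge i l)"
    and ?L = "one_weight (edge i j) (tri i j l) (edge i l)"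
    and ?R = "one_weight (edge i l) (tri i j l) (edge j l)"
    and ?T = "two_weight (edge i j) (tri i j l) (edge i l) (edge j l)"
  have bar: "bar tetra (\<lambda>as. triangle_form i j l as x) as =
      bar tetra ?P as * x $ tri i j l + bar tetra ?L as * x $ edge i j
      + bar tetra ?R as * x $ edge j l + bar tetra ?T as * x $ vtx j"
    unfolding triangle_form_def by (simp only: bar_linear)
  have lt: "i < l" "i \<le> 3" "j \<le> 3" using ijl by auto
  show ?thesis
  proof (cases "as = []")
    case True
    then show ?thesis using ijl lt by (simp add: triangle_form_def tetra_coords algebra_simps)
  next
    case False
    \<comment> \<open>\<open>u\<close> and \<open>v\<close> are the coefficients of
      \<open>x $ vtx i\<close> and \<open>x $ vtx l\<close> in the boundary. They vanish by the
      expansion of \<open>?L\<close> at the first letter and of \<open>?R\<close> at the last;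
      naming them lets the remaining identity be checked without splitting
      \<open>as\<close>.\<close>
    define u where "u = ?L as + (hd as $ edge i j * ?L (tl as) + hd as $ tri i j l * ?P (tl as))"
    define v where "v = ?R as + (?R (butlast as) * last as $ edge j l + ?P (butlast as) * last as $ tri i j l)"
    have "u = 0" using False by (cases as) (simp_all add: u_def)
    have "v = 0" using False by (cases as rule: rev_cases) (simp_all add: v_def)
    have "bar tetra (\<lambda>as. triangle_form i j l as x) as + triangle_form i j l as (diff tetra x)
        + (triangle_form i j l (tl as) (mul tetra x (hd as))
           + triangle_form i j l (butlast as) (mul tetra (last as) x))
      = pow_weight (edge i j) as * x $ edge i j + pow_weight (edge i l) as * x $ edge i l
        + pow_weight (edge j l) as * x $ edge j l + u * x $ vtx i + v * x $ vtx l"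
      unfolding bar
      unfolding bar_pow_weight_edges[OF ijl] bar_one_weight_left[OF ijl] bar_one_weight_right[OF ijl]
        bar_two_weight[OF ijl] triangle_form_def u_def v_def
      using False ijl lt by (simp add: tetra_coords algebra_simps)
    then show ?thesis using False \<open>u = 0\<close> \<open>v = 0\<close> by simp
  qed
qed

definition tetra_form :: "(bit ^ face) list \<Rightarrow> bit ^ face \<Rightarrow> bit" where
  "tetra_form as x = triangle_form 0 1 2 as x + triangle_form 0 1 3 as x
     + triangle_form 0 2 3 as x + triangle_form 1 2 3 as x"

lemma tetra_F_eq: "tetra_F as m bs n = (if bs = [] then tetra_form as (mul tetra m n) else 0)"
  by (simp add: tetra_F_def tetra_form_def local_family_eq)

lemma DF_tetra_F: "DF tetra tetra_F as m bs n = 0"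
proof -
  have 1: "tetra_form as (x + y) = tetra_form as x + tetra_form as y" for as x y
    by (simp add: tetra_form_def triangle_form_add add_ac)
  have "bar tetra (\<lambda>as. tetra_form as x) as + tetra_form as (diff tetra x)
      + (if as = [] then 0 else tetra_form (tl as) (mul tetra x (hd as))
           + tetra_form (butlast as) (mul tetra (last as) x)) = 0" (is "?lhs = 0") for x
  proof -
    let ?B = "\<lambda>i j l. bar tetra (\<lambda>as. triangle_form i j l as x) as + triangle_form i j l as (diff tetra x)
      + (if as = [] then 0 else triangle_form i j l (tl as) (mul tetra x (hd as))
           + triangle_form i j l (butlast as) (mul tetra (last as) x))"
    have "?lhs = ?B 0 1 2 + ?B 0 1 3 + ?B 0 2 3 + ?B 1 2 3"
      unfolding tetra_form_def bar_linear by (simp add: add_ac)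
    also have "\<dots> = 0"
      by (simp only: triangle_form_boundary) (simp add: triangle_form_boundary add_ac)
    finally show ?thesis .
  qed
  from this[of "mul tetra m n"] show ?thesis
    unfolding DF_cyclic_family[where F = tetra_F and g = tetra_form, OF unital_dga_tetra tetra_F_eq 1]
    by simp
qed

section \<open>Multilinearity and normalisation of the tetrahedral family\<close>

lemma multilinear_tetra_F: "multilinear_family tetra tetra_F"
proof -
  have "multilinear_family tetra (local_family i j l)" for i j l
    unfolding local_family_def tetra_def by (rule multilinear_family_of_support)
  then have "multilinear_family tetra (\<lambda>as m bs n. local_family 0 1 2 as m bs n
      + local_family 0 1 3 as m bs n + local_family 0 2 3 as m bs n + local_family 1 2 3 as m bs n)"
    by (intro multilinear_family_add scl_tetra)
  then show ?thesis by (simp add: tetra_F_def[abs_def])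
qed

text \<open>A letter whose listed coordinates vanish contributes a zero matrix. The unit is such a
  letter, having only vertex coordinates.\<close>

lemma weights_eq_0:
  assumes "a \<in> set as"
  shows "a $ p = 0 \<Longrightarrow> pow_weight p as = 0"
    and "a $ p = 0 \<Longrightarrow> a $ c = 0 \<Longrightarrow> a $ q = 0 \<Longrightarrow> one_weight p c q as = 0"
    and "a $ p = 0 \<Longrightarrow> a $ c = 0 \<Longrightarrow> a $ q = 0 \<Longrightarrow> a $ r = 0 \<Longrightarrow> two_weight p c q r as = 0"
proof -
  have pow: "pow_weight p as = 0" if "a \<in> set as" "a $ p = 0" for p as
    using that by (induction as) auto
  have one: "one_weight p c q as = 0"
    if "a \<in> set as" "a $ p = 0" "a $ c = 0" "a $ q = 0" for p q as
    using that by (induction as) (auto simp: pow)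
  have two: "two_weight p c q r as = 0"
    if "a \<in> set as" "a $ p = 0" "a $ c = 0" "a $ q = 0" "a $ r = 0" for as
    using that by (induction as) (auto simp: one)
  show "a $ p = 0 \<Longrightarrow> pow_weight p as = 0"
    and "a $ p = 0 \<Longrightarrow> a $ c = 0 \<Longrightarrow> a $ q = 0 \<Longrightarrow> one_weight p c q as = 0"
    and "a $ p = 0 \<Longrightarrow> a $ c = 0 \<Longrightarrow> a $ q = 0 \<Longrightarrow> a $ r = 0 \<Longrightarrow> two_weight p c q r as = 0"
    using assms pow one two by blast+
qed

lemma homotopy_inner_product_tetra_F: "homotopy_inner_product tetra tetra_F"
proof -
  have "triangle_form i j l as x = 0"
    if "unit tetra \<in> set as" "i < j" "j < l" "l \<le> 3" for i j l as x
    using that by (simp add: triangle_form_def weights_eq_0[OF that(1)] unit_tetra_coords)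
  then have "tetra_F as m bs n = 0" if "unit tetra \<in> set as \<union> set bs" for as m bs n
    using that by (auto simp: tetra_F_eq tetra_form_def)
  then show ?thesis
    by (simp add: homotopy_inner_product_def multilinear_tetra_F DF_tetra_F)
qed

section \<open>Comparison with the cohomology of the sphere\<close>

lemma UNIV_sphere_basis: "UNIV = {Ee, Ss}"
  by (auto intro: sphere_basis.exhaust)

lemma sphere_vec_eq_iff: "x = y \<longleftrightarrow> x $ Ee = y $ Ee \<and> x $ Ss = y $ Ss" for x y :: "'b ^ sphere_basis"
  by (metis (full_types) sphere_basis.exhaust vec_eq_iff)

lemma sphere_coords:
  "mul sphere_cohom x y $ Ee = x $ Ee * y $ Ee"
  "mul sphere_cohom x y $ Ss = x $ Ee * y $ Ss + x $ Ss * y $ Ee"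
  "unit sphere_cohom $ Ee = 1" "unit sphere_cohom $ Ss = 0"
  "diff sphere_cohom x = 0"
  by (simp_all add: sphere_cohom_def based_dga_def UNIV_sphere_basis axis_def)

lemma scl_sphere [simp]: "scl sphere_cohom = (*s)"
  and gr_sphere: "x \<in> gr sphere_cohom i \<longleftrightarrow> (x $ Ee \<noteq> 0 \<longrightarrow> i = 0) \<and> (x $ Ss \<noteq> 0 \<longrightarrow> i = -2)"
proof -
  show "x \<in> gr sphere_cohom i \<longleftrightarrow> (x $ Ee \<noteq> 0 \<longrightarrow> i = 0) \<and> (x $ Ss \<noteq> 0 \<longrightarrow> i = -2)"
    unfolding sphere_cohom_def based_dga_def dga.simps mem_Collect_eq
    by (metis (full_types) sphere_basis.exhaust sphere_basis.simps(3,4))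
qed (simp add: sphere_cohom_def based_dga_def)

lemma unital_dga_sphere: "unital_dga sphere_cohom"
proof -
  have u: "axis Ee 1 = unit sphere_cohom" by (simp add: sphere_cohom_def based_dga_def)
  show ?thesis
    unfolding sphere_cohom_def
  proof (rule unital_dga_based_dgaI; (fold sphere_cohom_def)?; (unfold u)?)
    show "sphere_mul \<alpha> \<beta> $ \<gamma> \<noteq> 0 \<Longrightarrow>
        case_sphere_basis 0 (- 2) \<gamma> = case_sphere_basis 0 (- 2) \<alpha> + (case_sphere_basis 0 (- 2) \<beta> :: int)"
      for \<alpha> \<beta> \<gamma>
      by (cases \<alpha>; cases \<beta>; cases \<gamma>) (auto simp: axis_def)
    show "unit sphere_cohom $ \<gamma> \<noteq> 0 \<Longrightarrow> case_sphere_basis 0 (- 2) \<gamma> = (0::int)" for \<gamma>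
      by (cases \<gamma>) (auto simp: sphere_coords)
  qed (simp_all add: sphere_vec_eq_iff sphere_coords algebra_simps)
qed

section \<open>The map from cohomology to cochains is a quasi-isomorphism\<close>

lemma sphere_to_tetra_coords:
  "i \<le> 3 \<Longrightarrow> sphere_to_tetra x $ vtx i = x $ Ee"
  "i < j \<Longrightarrow> j \<le> 3 \<Longrightarrow> sphere_to_tetra x $ edge i j = 0"
  "i < j \<Longrightarrow> j < l \<Longrightarrow> l \<le> 3 \<Longrightarrow>
    sphere_to_tetra x $ tri i j l = (if i = 0 \<and> j = 1 \<and> l = 2 then x $ Ss else 0)"
proof -
  have vertices: "{0..3} = {0, 1, 2, 3 :: nat}" by auto
  have sum: "sphere_to_tetra x = x $ Ee *s unit tetra + x $ Ss *s axis (tri 0 1 2) 1"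
    unfolding sphere_to_tetra_def unit_tetra vertices by (simp add: add_ac)
  have axis: "axis (tri 0 1 2) (1::bit) $ \<sigma> = of_bool (verts \<sigma> = {0, 1, 2})" for \<sigma>
  proof -
    have "\<sigma> = tri 0 1 2 \<longleftrightarrow> verts \<sigma> = {0, 1, 2}"
      using verts_tri[of 0 1 2] verts_inject[of \<sigma> "tri 0 1 2"] by simp
    then show ?thesis by (simp add: axis_def)
  qed
  have f: "sphere_to_tetra x $ \<sigma>
      = x $ Ee * unit tetra $ \<sigma> + x $ Ss * of_bool (verts \<sigma> = {0, 1, 2})" for \<sigma>
    by (simp only: sum vector_add_component vector_smult_component axis)
  show "sphere_to_tetra x $ vtx i = x $ Ee" if "i \<le> 3"
  proof -
    have "card {i} \<noteq> card {0, 1, 2 :: nat}" by simp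
    then have "{i} \<noteq> {0, 1, 2}" by metis
    then show ?thesis using that by (simp add: f unit_tetra_coords)
  qed
  show "sphere_to_tetra x $ edge i j = 0" if "i < j" "j \<le> 3"
  proof -
    have "card {i, j} \<noteq> card {0, 1, 2 :: nat}" using that by simp
    then have "{i, j} \<noteq> {0, 1, 2}" by metis
    then show ?thesis using that by (simp add: f unit_tetra_coords)
  qed
  show "sphere_to_tetra x $ tri i j l = (if i = 0 \<and> j = 1 \<and> l = 2 then x $ Ss else 0)"
    if "i < j" "j < l" "l \<le> 3"
  proof -
    have "{i, j, l} = {0, 1, 2} \<longleftrightarrow> i = 0 \<and> j = 1 \<and> l = 2"
    proof
      assume "{i, j, l} = {0, 1, 2}"
      then have "i \<in> {0, 1, 2}" "j \<in> {0, 1, 2}" "l \<in> {0, 1, 2}" by blast+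
      then show "i = 0 \<and> j = 1 \<and> l = 2" using that by auto
    qed auto
    then show ?thesis using that by (simp add: f unit_tetra_coords)
  qed
qed

lemma dga_map_sphere_to_tetra: "dga_map sphere_cohom tetra sphere_to_tetra"
  unfolding dga_map_def
proof (intro conjI allI unital_dga_sphere unital_dga_tetra)
  show "Vector_Spaces.linear (scl sphere_cohom) (scl tetra) sphere_to_tetra"
    unfolding scl_sphere scl_tetra
    by (rule linear_vec_vecI; rule face_vec_eqI; simp add: sphere_to_tetra_coords)
  show "sphere_to_tetra ` gr sphere_cohom i \<subseteq> gr tetra i" for i
    by (auto simp: gr_sphere sphere_to_tetra_coords split: if_splits intro!: gr_tetraI)
qed (rule face_vec_eqI; simp add: tetra_coords sphere_coords sphere_to_tetra_coords unit_tetra_coords)+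

text \<open>The preimage comes from coning off with vertex 0.\<close>

lemma tetra_boundaryI:
  assumes t: "t \<in> cycles tetra i" and vtx: "t $ vtx 0 = 0"
    and tri: "t $ tri 0 1 2 + t $ tri 0 1 3 + t $ tri 0 2 3 + t $ tri 1 2 3 = 0"
  shows "t \<in> diff tetra ` gr tetra (i + 1)"
proof -
  define z where "z = (\<chi> \<sigma>. if 0 \<in> verts \<sigma> \<or> card (verts \<sigma>) = 3 then 0 else t $ Face (insert 0 (verts \<sigma>)))"
  have z: "p \<le> 3 \<Longrightarrow> z $ vtx p = (if p = 0 then 0 else t $ edge 0 p)"
    "p < q \<Longrightarrow> q \<le> 3 \<Longrightarrow> z $ edge p q = (if p = 0 then 0 else t $ tri 0 p q)"
    "p < q \<Longrightarrow> q < r \<Longrightarrow> r \<le> 3 \<Longrightarrow> z $ tri p q r = 0" for p q r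
    by (auto simp: z_def)
  have d: "diff tetra t = 0" using t by (simp add: cycles_def)
  \<comment> \<open>Closedness makes \<open>t\<close> constant on vertices, hence zero by its value
    at vertex 0.\<close>
  have tv: "t $ vtx p = 0" if "p \<le> 3" for p
    using diff_tetra_edge[of 0 p t] that vtx d by (cases "p = 0") auto
  have te: "t $ edge p q = t $ edge 0 p + t $ edge 0 q" if "0 < p" "p < q" "q \<le> 3" for p q
    using diff_tetra_tri[of 0 p q t] that d by (simp add: bit_add_eq_0_iff)
  \<comment> \<open>The only triangle avoiding vertex 0 is \<open>tri 1 2 3\<close>. As the solid
    tetrahedron is missing, closedness gives no relation there, and the vanishing total
    \<open>tri\<close> takes its place.\<close>
  have tt: "t $ tri p q r = t $ tri 0 p q + t $ tri 0 p r + t $ tri 0 q r"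
    if "0 < p" "p < q" "q < r" "r \<le> 3" for p q r
  proof -
    have "p = 1" "q = 2" "r = 3" using that by auto
    then show ?thesis using tri by (simp add: bit_add_eq_0_iff)
  qed
  have deg: "1 - int (card (verts \<sigma>)) = i" if "t $ \<sigma> \<noteq> 0" for \<sigma>
    using t that by (auto simp: cycles_def gr_tetra)
  have "diff tetra z = t"
    by (rule face_vec_eqI) (auto simp: tetra_coords z tv te tt)
  moreover have "z \<in> gr tetra (i + 1)"
    by (rule gr_tetraI) (auto simp: z split: if_splits dest!: deg)
  ultimately show ?thesis by blast
qed

text \<open>Two functionals detect homology: the value at vertex 0, and the total over the four
  triangles, which is evaluation on the fundamental class. They take the values
  \<open>x $ Ee\<close> and \<open>x $ Ss\<close> on the image of \<open>x\<close>.\<close>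

lemma quasi_iso_sphere_to_tetra: "dga_quasi_iso sphere_cohom tetra sphere_to_tetra"
proof (rule dga_quasi_isoI[OF dga_map_sphere_to_tetra])
  fix i x assume "sphere_to_tetra x \<in> diff tetra ` gr tetra (i + 1)"
  then obtain z where z: "sphere_to_tetra x = diff tetra z" by blast
  have "x $ Ee = 0"
    using arg_cong[OF z, of "\<lambda>y. y $ vtx 0"] by (simp add: sphere_to_tetra_coords tetra_coords)
  moreover have "x $ Ss = 0"
    \<comment> \<open>The total of a coboundary counts each edge twice.\<close>
    using arg_cong[OF z, of "\<lambda>y. y $ tri 0 1 2 + y $ tri 0 1 3 + y $ tri 0 2 3 + y $ tri 1 2 3"]
    by (simp add: sphere_to_tetra_coords tetra_coords add_ac)
  ultimately have "x = diff sphere_cohom 0" by (simp add: sphere_vec_eq_iff sphere_coords)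
  moreover have "0 \<in> gr sphere_cohom (i + 1)" by (simp add: gr_sphere)
  ultimately show "x \<in> diff sphere_cohom ` gr sphere_cohom (i + 1)" by (rule image_eqI)
next
  fix i y assume y: "y \<in> cycles tetra i"
  have deg: "1 - int (card (verts \<sigma>)) = i" if "y $ \<sigma> \<noteq> 0" for \<sigma>
    using y that by (auto simp: cycles_def gr_tetra)
  define s where "s = y $ tri 0 1 2 + y $ tri 0 1 3 + y $ tri 0 2 3 + y $ tri 1 2 3"
  define x where "x = (\<chi> \<beta>. case \<beta> of Ee \<Rightarrow> y $ vtx 0 | Ss \<Rightarrow> s)"
  have x: "x $ Ee = y $ vtx 0" "x $ Ss = s" by (simp_all add: x_def)
  \<comment> \<open>Homogeneity of \<open>y\<close> puts each non-zero coordinate of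
    \<open>x\<close> in the right degree.\<close>
  have "i = -2" if "s \<noteq> 0"
  proof -
    have "y $ tri 0 1 2 \<noteq> 0 \<or> y $ tri 0 1 3 \<noteq> 0 \<or> y $ tri 0 2 3 \<noteq> 0 \<or> y $ tri 1 2 3 \<noteq> 0"
      using that unfolding s_def by (metis add.right_neutral)
    then show ?thesis by (auto dest!: deg)
  qed
  moreover have "i = 0" if "y $ vtx 0 \<noteq> 0" using deg[OF that] by simp
  ultimately have "x \<in> cycles sphere_cohom i"
    by (simp add: cycles_def gr_sphere x sphere_coords)
  moreover have "y - sphere_to_tetra x \<in> diff tetra ` gr tetra (i + 1)"
  proof (rule tetra_boundaryI)
    have fx: "sphere_to_tetra x \<in> cycles tetra i"
    proof -
      have "diff tetra (sphere_to_tetra x) = 0"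
        by (rule face_vec_eqI; simp add: tetra_coords sphere_to_tetra_coords)
      moreover have "sphere_to_tetra x \<in> gr tetra i"
        using dga_map_sphere_to_tetra \<open>x \<in> cycles sphere_cohom i\<close>
        by (auto simp: dga_map_def cycles_def)
      ultimately show ?thesis by (simp add: cycles_def)
    qed
    interpret A: unital_dga tetra by (rule unital_dga_tetra)
    interpret d: Vector_Spaces.linear "scl tetra" "scl tetra" "diff tetra" by (rule A.diff_linear)
    show "y - sphere_to_tetra x \<in> cycles tetra i"
      using y fx A.subspace_diff[OF A.gr_subspace] by (simp add: cycles_def d.diff)
  qed (simp_all add: sphere_to_tetra_coords x s_def add_ac)
  ultimately show "\<exists>x\<in>cycles sphere_cohom i. y - sphere_to_tetra x \<in> diff tetra ` gr tetra (i + 1)"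
    by blast
qed

section \<open>The transferred inner product\<close>

lemma sphere_F_eq:
  "sphere_F as m bs n = (if bs = [] then
     of_bool (as = []) * (m $ Ee * n $ Ss + m $ Ss * n $ Ee)
     + (case as of [a, b] \<Rightarrow> a $ Ss * b $ Ss | _ \<Rightarrow> 0) * (m $ Ee * n $ Ee) else 0)"
proof (cases bs)
  case Nil
  have pair_sum: "(\<Sum>\<mu>\<in>UNIV. m $ \<mu> * (\<Sum>\<nu>\<in>UNIV. n $ \<nu> * of_bool ((\<alpha>, \<mu>, [], \<nu>) \<in>
      {([], Ss, [], Ee), ([], Ee, [], Ss), ([Ss, Ss], Ee, [], Ee)})))
    = (m $ Ee * n $ Ss + m $ Ss * n $ Ee) * of_bool (\<alpha> = []) + (m $ Ee * n $ Ee) * of_bool (\<alpha> = [Ss, Ss])" for \<alpha>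
    by (simp add: UNIV_sphere_basis)
  have nil: "word_sum (\<lambda>\<alpha>. of_bool (\<alpha> = [])) as = of_bool (as = [])"
    for as :: "(bit ^ sphere_basis) list"
    by (cases as) simp_all
  have two: "word_sum (\<lambda>\<alpha>. of_bool (\<alpha> = [Ss, Ss])) as = (case as of [a, b] \<Rightarrow> a $ Ss * b $ Ss | _ \<Rightarrow> 0)"
    by (auto simp: UNIV_sphere_basis split: list.split)
  show ?thesis
    unfolding sphere_F_def family_of_support_word_sum Nil word_sum.simps(1) pair_sum
    by (simp only: word_sum_add word_sum_cmul nil two) (simp add: mult.commute)
next
  case (Cons b bs')
  then show ?thesis by (simp add: sphere_F_def family_of_support_word_sum)
qed

text \<open>Images under \<open>sphere_to_tetra\<close> have no edge coordinates, so their matrices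
  are strictly upper triangular. Hence \<open>pow_weight\<close> survives only on the empty word,
  giving the \<open>Ss\<close>-coordinate of \<open>m n\<close>, and \<open>two_weight\<close> only
  on two letters and the triangle 012, giving the value at \<open>Ss, Ss\<close>. The terms with
  \<open>one_weight\<close> carry an edge coordinate of the image of \<open>m n\<close> and drop
  out.\<close>

lemma transferred_tetra_F: "transferred sphere_to_tetra tetra_F = sphere_F"
proof (intro ext)
  fix as m bs n
  have f_mul: "mul tetra (sphere_to_tetra m) (sphere_to_tetra n) = sphere_to_tetra (mul sphere_cohom m n)"
    using dga_map_sphere_to_tetra by (simp add: dga_map_def)
  have pow: "pow_weight (edge i j) (map sphere_to_tetra as) = of_bool (as = [])"
    if "i < j" "j \<le> 3" for i j as
    using that by (cases as) (simp_all add: sphere_to_tetra_coords)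
  have two: "two_weight (edge i j) (tri i j l) (edge i l) (edge j l) (map sphere_to_tetra as)
      = (if i = 0 \<and> j = 1 \<and> l = 2 then case as of [a, b] \<Rightarrow> a $ Ss * b $ Ss | _ \<Rightarrow> 0 else 0)"
    if "i < j" "j < l" "l \<le> 3" for i j l
    using that by (auto simp: sphere_to_tetra_coords pow split: list.split)
  show "transferred sphere_to_tetra tetra_F as m bs n = sphere_F as m bs n"
    by (simp add: transferred_def tetra_F_eq f_mul tetra_form_def triangle_form_def pow two
        sphere_to_tetra_coords sphere_F_eq sphere_coords algebra_simps)
qed

theorem proposition4p23:
  shows "dga_quasi_iso sphere_cohom tetra sphere_to_tetra
    \<and> homotopy_inner_product tetra tetra_F
    \<and> homotopy_inner_product sphere_cohom sphere_F
    \<and> transferred sphere_to_tetra tetra_F = sphere_F"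
  using homotopy_inner_product_transferred[OF dga_map_sphere_to_tetra homotopy_inner_product_tetra_F]
  by (simp add: quasi_iso_sphere_to_tetra homotopy_inner_product_tetra_F transferred_tetra_F)

end
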